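(* Let $L>0$. There is no explicit Runge--Kutta method (with real coefficients $a_{ij}$, $b_i$) that simultaneously (i) is strong stability preserving with positive SSP coefficient, (ii) is of at least second order of accuracy and has at most three stages, and (iii) is strongly stable for $\frac{d}{dt}u(t)=g(u(t))$, $u(0)=u_0$, for all smooth and semibounded $g$ with $|g|_{\mathrm{Lip}}\le L$.
   Context: ODE setting: $\mathcal{H}$ is a real vector space with semi inner product $\langle\cdot,\cdot\rangle$ and induced seminorm $\|\cdot\|$ (e.g. a real Hilbert space such as $\mathbb{R}^2$ with the Euclidean inner product), $g\colon\mathcal{H}\to\mathcal{H}$, and the autonomous ODE is $\frac{d}{dt}u(t)=g(u(t))$, $u(0)=u_0\in\mathcal{H}$. The function $g$ is semibounded if $\langle u,g(u)\rangle\le 0$ for all $u\in\mathcal{H}$. Its Lipschitz seminorm is $|g|_{\mathrm{Lip}}=\sup_{u\ne v}\|g(u)-g(v)\|/\|u-v\|$. Smooth means infinitely differentiable. "For all $g$" refers to all such spaces $\mathcal{H}$ and all such $g$ on them. Explicit Runge--Kutta method with $s$ stages: given by real coefficients $a_{ij}$ ($1\le j<i\le s$; $a_{ij}=0$ for $j\ge i$) and $b_1,\dots,b_s$; one step of size $\Delta t>0$ from $u_0$ to $u_+$ is $u_i=u_0+\Delta t\sum_{j=1}^{i-1}a_{ij}g(u_j)$ for $i=1,\dots,s$, and $u_+=u_0+\Delta t\sum_{i=1}^s b_i g(u_i)$. Order: the method is of at least second order of accuracy iff $\sum_j b_j=1$ and $\sum_{j,k}b_ja_{jk}=\frac12$.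 Strong stability: the method is strongly stable for the ODE with semibounded $g$ if there is $\Delta t_{\max}>0$ (possibly depending on $g$) such that $\|u_+\|^2\le\|u_0\|^2$ for all $u_0\in\mathcal{H}$ and all $\Delta t\in(0,\Delta t_{\max}]$. SSP: the method is strong stability preserving with SSP coefficient $c>0$ if for every autonomous ODE $\frac{d}{dt}u(t)=g(u(t))$, $u(0)=u_0\in\mathcal{H}$ (every real vector space $\mathcal{H}$ with semi inner product and every $g\colon\mathcal{H}\to\mathcal{H}$), every convex functional $\eta\colon\mathcal{H}\to\mathbb{R}$ and every $\Delta t_E>0$: if $\eta(u_0+\Delta t\,g(u_0))\le\eta(u_0)$ for all $u_0\in\mathcal{H}$ and $\Delta t\in(0,\Delta t_E]$, then $\eta(u_+)\le\eta(u_0)$ for all $u_0\in\mathcal{H}$ and $\Delta t\in(0,c\,\Delta t_E]$. *)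

theory Defs
  imports Complex_Main "HOL-Library.FuncSet" "HOL-Library.Extended_Nonnegative_Real"
    "HOL-Analysis.Convex"
begin

section \<open>Real vector spaces with a semi inner product\<close>

text \<open>
  HOL cannot quantify over types inside a formula, so "all spaces" means: all linear subspaces
  \<open>V\<close> of an ambient vector space \<open>'u\<close>, each with an arbitrary semi inner product of its own.
  The ambient space has to be large, see \<open>large_ambient\<close> below. A map on the space \<open>V\<close> is a
  HOL function \<open>'u \<Rightarrow> 'u\<close> that maps \<open>V\<close> into \<open>V\<close>; its values outside \<open>V\<close> are irrelevant.
\<close>

definition semi_inner_space :: "'u::real_vector set \<Rightarrow> ('u \<Rightarrow> 'u \<Rightarrow> real) \<Rightarrow> bool" where
  "semi_inner_space V ip \<longleftrightarrow>
     subspace V \<and>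
     (\<forall>x\<in>V. \<forall>y\<in>V. ip x y = ip y x) \<and>
     (\<forall>x\<in>V. \<forall>y\<in>V. \<forall>z\<in>V. ip (x + y) z = ip x z + ip y z) \<and>
     (\<forall>r. \<forall>x\<in>V. \<forall>y\<in>V. ip (r *\<^sub>R x) y = r * ip x y) \<and>
     (\<forall>x\<in>V. 0 \<le> ip x x)"

definition seminorm :: "('u \<Rightarrow> 'u \<Rightarrow> real) \<Rightarrow> 'u \<Rightarrow> real" where
  "seminorm ip x = sqrt (ip x x)"

text \<open>
  The dimension of \<open>'u\<close> is at least that of the continuum, so that every real vector space
  of dimension at most the continuum occurs as a subspace (and larger \<open>'u\<close> give larger spaces).
  Whether a method is strong stability preserving, or strongly stable for all smooth semibounded
  \<open>g\<close> with bounded Lipschitz seminorm, does not depend on the choice of such a \<open>'u\<close>: a failure of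
  either property in some space involves only countably many initial values and step sizes;
  these lie in a subspace of cardinality at most the continuum that is closed under \<open>g\<close> and, for
  smooth \<open>g\<close>, under its derivatives, and the failure persists in that subspace.
\<close>

definition large_ambient :: "'u::real_vector itself \<Rightarrow> bool" where
  "large_ambient _ \<longleftrightarrow> (\<exists>e :: real \<Rightarrow> 'u. inj e \<and> independent (range e))"

section \<open>Properties of the right-hand side\<close>

definition semibounded_on ::
    "'u set \<Rightarrow> ('u \<Rightarrow> 'u \<Rightarrow> real) \<Rightarrow> ('u \<Rightarrow> 'u) \<Rightarrow> bool" where
  "semibounded_on V ip g \<longleftrightarrow> (\<forall>u\<in>V. ip u (g u) \<le> 0)"

text \<open>
  The quotients are formed in \<open>ennreal\<close>, where \<open>0 / 0 = 0\<close> and \<open>c / 0 = \<infinity>\<close> for \<open>c > 0\<close>. This settles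
  pairs \<open>u \<noteq> v\<close> with vanishing seminorm of \<open>u - v\<close>, and maps that are not Lipschitz get \<open>\<infinity>\<close>.
\<close>

definition lip_seminorm ::
    "'u::real_vector set \<Rightarrow> ('u \<Rightarrow> 'u \<Rightarrow> real) \<Rightarrow> ('u \<Rightarrow> 'u) \<Rightarrow> ennreal" where
  "lip_seminorm V ip g =
     (SUP (u, v) \<in> {(u, v). u \<in> V \<and> v \<in> V \<and> u \<noteq> v}.
        ennreal (seminorm ip (g u - g v)) / ennreal (seminorm ip (u - v)))"

text \<open>\<open>k\<close>-linear maps \<open>V\<^sup>k \<rightarrow> V\<close>, with the argument tuple given as a list of length \<open>k\<close>.\<close>

definition bounded_multilinear_on ::
    "'u::real_vector set \<Rightarrow> ('u \<Rightarrow> 'u \<Rightarrow> real) \<Rightarrow> nat \<Rightarrow> ('u list \<Rightarrow> 'u) \<Rightarrow> bool" where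
  "bounded_multilinear_on V ip k T \<longleftrightarrow>
     (\<forall>vs. set vs \<subseteq> V \<and> length vs = k \<longrightarrow> T vs \<in> V) \<and>
     (\<forall>vs. set vs \<subseteq> V \<and> length vs = k \<longrightarrow>
        (\<forall>i<k. \<forall>x\<in>V. \<forall>y\<in>V. \<forall>r.
           T (vs[i := x + y]) = T (vs[i := x]) + T (vs[i := y]) \<and>
           T (vs[i := r *\<^sub>R x]) = r *\<^sub>R T (vs[i := x]))) \<and>
     (\<exists>C. \<forall>vs. set vs \<subseteq> V \<and> length vs = k \<longrightarrow>
        seminorm ip (T vs) \<le> C * prod_list (map (seminorm ip) vs))"

text \<open>
  Infinitely often Frechet differentiable with respect to the seminorm: \<open>D k x\<close> is the \<open>k\<close>-th
  derivative of \<open>g\<close> at \<open>x\<close>, a bounded \<open>k\<close>-linear map, and \<open>D (Suc k)\<close> is the Frechet derivative of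
  \<open>D k\<close> with respect to the operator seminorm on \<open>k\<close>-linear maps; the direction \<open>h\<close> of the
  outermost derivative is the first argument.
\<close>

definition smooth_map ::
    "'u::real_vector set \<Rightarrow> ('u \<Rightarrow> 'u \<Rightarrow> real) \<Rightarrow> ('u \<Rightarrow> 'u) \<Rightarrow> bool" where
  "smooth_map V ip g \<longleftrightarrow>
     (\<exists>D :: nat \<Rightarrow> 'u \<Rightarrow> 'u list \<Rightarrow> 'u.
        (\<forall>x\<in>V. D 0 x [] = g x) \<and>
        (\<forall>k. \<forall>x\<in>V. bounded_multilinear_on V ip k (D k x)) \<and>
        (\<forall>k. \<forall>x\<in>V. \<forall>\<epsilon>>0. \<exists>\<delta>>0. \<forall>h\<in>V. seminorm ip h < \<delta> \<longrightarrow>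
           (\<forall>vs. set vs \<subseteq> V \<and> length vs = k \<longrightarrow>
              seminorm ip (D k (x + h) vs - D k x vs - D (Suc k) x (h # vs))
                \<le> \<epsilon> * seminorm ip h * prod_list (map (seminorm ip) vs))))"

section \<open>Explicit Runge--Kutta methods\<close>

text \<open>A method with \<open>s\<close> stages is given by coefficients \<open>a i j\<close>, \<open>b i\<close> with indices in \<open>{1..s}\<close>;
  values of \<open>a\<close> and \<open>b\<close> at other indices are never used.\<close>

definition explicit_rk :: "nat \<Rightarrow> (nat \<Rightarrow> nat \<Rightarrow> real) \<Rightarrow> bool" where
  "explicit_rk s a \<longleftrightarrow> (\<forall>i\<in>{1..s}. \<forall>j\<in>{1..s}. i \<le> j \<longrightarrow> a i j = 0)"

fun rk_stage ::
    "(nat \<Rightarrow> nat \<Rightarrow> real) \<Rightarrow> ('u::real_vector \<Rightarrow> 'u) \<Rightarrow> real \<Rightarrow> 'u \<Rightarrow> nat \<Rightarrow> 'u" where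
  "rk_stage a g dt u0 i =
     u0 + dt *\<^sub>R (\<Sum>j\<in>{1..<i}. a i j *\<^sub>R g (rk_stage a g dt u0 j))"

declare rk_stage.simps [simp del]

definition rk_step ::
    "nat \<Rightarrow> (nat \<Rightarrow> nat \<Rightarrow> real) \<Rightarrow> (nat \<Rightarrow> real) \<Rightarrow> ('u::real_vector \<Rightarrow> 'u) \<Rightarrow> real \<Rightarrow> 'u \<Rightarrow> 'u" where
  "rk_step s a b g dt u0 =
     u0 + dt *\<^sub>R (\<Sum>i\<in>{1..s}. b i *\<^sub>R g (rk_stage a g dt u0 i))"

definition at_least_second_order ::
    "nat \<Rightarrow> (nat \<Rightarrow> nat \<Rightarrow> real) \<Rightarrow> (nat \<Rightarrow> real) \<Rightarrow> bool" where
  "at_least_second_order s a b \<longleftrightarrow>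
     (\<Sum>j\<in>{1..s}. b j) = 1 \<and> (\<Sum>j\<in>{1..s}. \<Sum>k\<in>{1..s}. b j * a j k) = 1 / 2"

definition strongly_stable ::
    "nat \<Rightarrow> (nat \<Rightarrow> nat \<Rightarrow> real) \<Rightarrow> (nat \<Rightarrow> real) \<Rightarrow>
     'u::real_vector set \<Rightarrow> ('u \<Rightarrow> 'u \<Rightarrow> real) \<Rightarrow> ('u \<Rightarrow> 'u) \<Rightarrow> bool" where
  "strongly_stable s a b V ip g \<longleftrightarrow>
     (\<exists>dtmax>0. \<forall>u0\<in>V. \<forall>dt\<in>{0<..dtmax}.
        (seminorm ip (rk_step s a b g dt u0))\<^sup>2 \<le> (seminorm ip u0)\<^sup>2)"

definition strong_stability_preserving ::
    "'u::real_vector itself \<Rightarrow> nat \<Rightarrow> (nat \<Rightarrow> nat \<Rightarrow> real) \<Rightarrow> (nat \<Rightarrow> real) \<Rightarrow> real \<Rightarrow> bool" where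
  "strong_stability_preserving _ s a b c \<longleftrightarrow>
     (\<forall>(V :: 'u set) ip g \<eta> dtE.
        semi_inner_space V ip \<and> g \<in> V \<rightarrow> V \<and> convex_on V \<eta> \<and> dtE > 0 \<and>
        (\<forall>u0\<in>V. \<forall>dt\<in>{0<..dtE}. \<eta> (u0 + dt *\<^sub>R g u0) \<le> \<eta> u0)
        \<longrightarrow> (\<forall>u0\<in>V. \<forall>dt\<in>{0<..c * dtE}. \<eta> (rk_step s a b g dt u0) \<le> \<eta> u0))"

end

theory Submission
  imports Defs "HOL-Analysis.Analysis"
begin

text \<open>
  For every explicit method of second order with at most three stages, a smooth semibounded
  field with a prescribed Lipschitz constant is built for which single steps of arbitrarily small
  size increase the norm; the field may depend on the method.

  The field lives on a plane and is everywhere orthogonal to the position \<open>u\<close>, so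
  \<open>\<langle>u, g u\<rangle> = 0\<close>. The exact solutions keep their norm, and the change of energy in one step is the
  quadratic form \<open>t\<^sup>2 \<Sum>\<^sub>i\<^sub>j M\<^sub>i\<^sub>j \<langle>g\<^sub>i, g\<^sub>j\<rangle>\<close> in the slopes at the stages, with
  \<open>M\<^sub>i\<^sub>j = b\<^sub>i b\<^sub>j - b\<^sub>i a\<^sub>i\<^sub>j - b\<^sub>j a\<^sub>j\<^sub>i\<close>. Second order means that the entries of \<open>M\<close> sum to \<open>0\<close>. A Lipschitz field changes
  little over one small step, so with the differences \<open>\<delta>\<^sub>j\<close> to the first slope \<open>e\<close> the form
  is \<open>2 \<Sum>\<^sub>j m\<^sub>j \<langle>e, \<delta>\<^sub>j\<rangle> + \<Sum>\<^sub>i\<^sub>j M\<^sub>i\<^sub>j \<langle>\<delta>\<^sub>i, \<delta>\<^sub>j\<rangle>\<close>, where \<open>m\<^sub>j\<close> are the row sums (lemma \<open>energy_change\<close>).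

  If the linear part does not vanish on the admissible differences, their sign can be chosen so
  that the energy grows. If it does vanish, the diagonal entries of the quadratic part
  are \<open>b\<^sub>j\<^sup>2\<close>: a field that
  differs from \<open>e\<close> only at one stage of nonzero weight makes the energy grow. The difficulty is that
  stages may coincide or lie closer together than the step size, so that the \<open>\<delta>\<^sub>j\<close> are not independent;
  lemma \<open>exists_growing_profile\<close> settles these cases.

  One fixed field has to work for arbitrarily small \<open>t\<close>. It is a rotation plus a bounded field whose
  strength depends on one coordinate through a profile \<open>h\<close>. As the rotation grows linearly, starting at
  distance proportional to \<open>1 / t\<close> from the centre spreads the stages over distances of order one, so
  that the profile can tell them apart for every \<open>t\<close>. Lemma \<open>swirl_energy_growth\<close> makes this
  precise; scaling of time then adjusts the Lipschitz constant.
\<close>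

section \<open>Smoothness of elementary vector fields\<close>

text \<open>
  In finite dimension both requirements of \<^const>\<open>smooth_map\<close> on the multilinear maps, boundedness
  and the uniform estimate of the Frechet remainder, reduce to finitely many tuples of basis
  vectors: a multilinear map is controlled by its values there.
\<close>

lemma multilinear_bound_of_basis_bound:
  fixes S :: "'e::euclidean_space list \<Rightarrow> 'f::real_normed_vector"
  assumes lin: "\<And>vs i. length vs = k \<Longrightarrow> i < k \<Longrightarrow> linear (\<lambda>v. S (vs[i := v]))"
    and basis: "\<And>vs. length vs = k \<Longrightarrow> set vs \<subseteq> Basis \<Longrightarrow> norm (S vs) \<le> C"
    and len: "length vs = k"
  shows "norm (S vs) \<le> C * real DIM('e) ^ k * prod_list (map norm vs)"
  using assms
proof (induction k arbitrary: S vs)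
  case 0
  then show ?case by simp
next
  case (Suc k)
  obtain v ws where vs: "vs = v # ws" and ws: "length ws = k"
    using Suc.prems(3) by (auto simp: length_Suc_conv)
  define D where "D = real DIM('e)"
  define P where "P = prod_list (map norm ws)"
  have head: "linear (\<lambda>v. S (v # ws))"
    using Suc.prems(1)[of "v # ws" 0] ws by simp
  have tail: "norm (S (b # ws)) \<le> C * D ^ k * P" if b: "b \<in> Basis" for b
    unfolding D_def P_def
  proof (rule Suc.IH[OF _ _ ws])
    show "linear (\<lambda>u. S (b # us[i := u]))" if "length us = k" "i < k" for us i
      using Suc.prems(1)[of "b # us" "Suc i"] that by simp
    show "norm (S (b # us)) \<le> C" if "length us = k" "set us \<subseteq> Basis" for us
      using Suc.prems(2)[of "b # us"] that b by simp
  qed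
  have "S vs = S ((\<Sum>b\<in>Basis. (v \<bullet> b) *\<^sub>R b) # ws)"
    by (simp add: vs euclidean_representation)
  also have "\<dots> = (\<Sum>b\<in>Basis. (v \<bullet> b) *\<^sub>R S (b # ws))"
    using linear_sum[OF head, of "\<lambda>b. (v \<bullet> b) *\<^sub>R b" Basis]
    by (simp add: linear_cmul[OF head])
  finally have "norm (S vs) \<le> (\<Sum>b\<in>Basis. norm ((v \<bullet> b) *\<^sub>R S (b # ws)))"
    by (simp only: norm_sum)
  also have "\<dots> \<le> (\<Sum>b\<in>(Basis :: 'e set). norm v * (C * D ^ k * P))"
  proof (rule sum_mono)
    fix b :: 'e assume b: "b \<in> Basis"
    show "norm ((v \<bullet> b) *\<^sub>R S (b # ws)) \<le> norm v * (C * D ^ k * P)"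
      using mult_mono[OF Basis_le_norm[OF b, of v] tail[OF b]] by simp
  qed
  also have "\<dots> = C * D ^ Suc k * prod_list (map norm vs)"
    by (simp add: vs D_def P_def)
  finally show ?case by (simp only: D_def)
qed

text \<open>
  The newest direction is at the head of the list, as in \<^const>\<open>smooth_map\<close>.
\<close>

fun iterated_derivative ::
    "('e::real_normed_vector \<Rightarrow> 'e) \<Rightarrow> 'e list \<Rightarrow> 'e \<Rightarrow> 'e" where
  "iterated_derivative F [] = F"
| "iterated_derivative F (h # vs) =
     (\<lambda>x. frechet_derivative (iterated_derivative F vs) (at x) h)"

text \<open>
  A coinductive form of smoothness: on a Euclidean space, a class of differentiable maps that contains
  the directional derivatives of its members consists of smooth maps. It spares writing down any higher derivative.
\<close>

definition closed_under_derivatives :: "('e::real_normed_vector \<Rightarrow> 'e) set \<Rightarrow> bool" where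
  "closed_under_derivatives G \<longleftrightarrow>
     (\<forall>F\<in>G. (\<forall>x. F differentiable (at x)) \<and> (\<forall>h. (\<lambda>x. frechet_derivative F (at x) h) \<in> G))"

lemma iterated_derivative_mem:
  assumes "closed_under_derivatives G" "F \<in> G"
  shows "iterated_derivative F vs \<in> G"
  using assms by (induction vs) (auto simp: closed_under_derivatives_def)

lemma has_derivative_iterated:
  assumes "closed_under_derivatives G" "F \<in> G"
  shows "(iterated_derivative F vs has_derivative (\<lambda>h. iterated_derivative F (h # vs) x)) (at x)"
  using iterated_derivative_mem[OF assms, of vs] assms(1)
  by (auto simp: closed_under_derivatives_def frechet_derivative_works)

text \<open>
  In the first slot this is linearity of the derivative. In a later slot the dependence is linear
  at every point by induction, as an identity of functions, which may then be differentiated.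
\<close>

lemma linear_iterated_derivative:
  assumes G: "closed_under_derivatives G" "F \<in> G" and "i < length vs"
  shows "linear (\<lambda>v. iterated_derivative F (vs[i := v]) x)"
  using assms(3)
proof (induction vs arbitrary: i x)
  case Nil
  then show ?case by simp
next
  case (Cons h vs)
  note hd = has_derivative_iterated[OF G]
  show ?case
  proof (cases i)
    case 0
    then show ?thesis
      using has_derivative_linear[OF hd[of vs x]] by simp
  next
    case (Suc j)
    then have j: "j < length vs" using Cons.prems by simp
    note lin = Cons.IH[OF j]
    show ?thesis
    proof (rule linearI)
      fix v w
      have eq: "iterated_derivative F (vs[j := v + w]) =
          (\<lambda>y. iterated_derivative F (vs[j := v]) y + iterated_derivative F (vs[j := w]) y)"
        by (rule ext) (rule linear_add[OF lin])
      have "(iterated_derivative F (vs[j := v + w]) has_derivative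
          (\<lambda>h. iterated_derivative F (h # vs[j := v]) x + iterated_derivative F (h # vs[j := w]) x))
          (at x)"
        unfolding eq by (rule has_derivative_add[OF hd hd])
      then have "(\<lambda>h. iterated_derivative F (h # vs[j := v + w]) x) =
          (\<lambda>h. iterated_derivative F (h # vs[j := v]) x + iterated_derivative F (h # vs[j := w]) x)"
        using has_derivative_unique hd by blast
      from fun_cong[OF this, of h]
      show "iterated_derivative F ((h # vs)[i := v + w]) x =
          iterated_derivative F ((h # vs)[i := v]) x + iterated_derivative F ((h # vs)[i := w]) x"
        by (simp add: Suc)
    next
      fix r v
      have eq: "iterated_derivative F (vs[j := r *\<^sub>R v]) =
          (\<lambda>y. r *\<^sub>R iterated_derivative F (vs[j := v]) y)"
        by (rule ext) (rule linear_cmul[OF lin])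
      have "(iterated_derivative F (vs[j := r *\<^sub>R v]) has_derivative
          (\<lambda>h. r *\<^sub>R iterated_derivative F (h # vs[j := v]) x)) (at x)"
        unfolding eq by (rule has_derivative_scaleR_right[OF hd])
      then have "(\<lambda>h. iterated_derivative F (h # vs[j := r *\<^sub>R v]) x) =
          (\<lambda>h. r *\<^sub>R iterated_derivative F (h # vs[j := v]) x)"
        using has_derivative_unique hd by blast
      from fun_cong[OF this, of h]
      show "iterated_derivative F ((h # vs)[i := r *\<^sub>R v]) x =
          r *\<^sub>R iterated_derivative F ((h # vs)[i := v]) x"
        by (simp add: Suc)
    qed
  qed
qed

lemma seminorm_inner: "seminorm (\<bullet>) = norm"
  by (rule ext) (simp add: seminorm_def norm_eq_sqrt_inner)

lemma smooth_map_if_closed_under_derivatives: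
  fixes F :: "'e::euclidean_space \<Rightarrow> 'e"
  assumes G: "closed_under_derivatives G" "F \<in> G"
  shows "smooth_map UNIV (\<bullet>) F"
  unfolding smooth_map_def
proof (rule exI[of _ "\<lambda>k x vs. iterated_derivative F vs x"], intro conjI allI ballI impI)
  let ?D = "\<lambda>(k::nat) x vs. iterated_derivative F vs x"
  define B where "B k = {bs :: 'e list. set bs \<subseteq> Basis \<and> length bs = k}" for k
  have finB: "finite (B k)" for k
    unfolding B_def by (rule finite_lists_length_eq) simp
  have Bmem: "bs \<in> B (length bs)" if "set bs \<subseteq> Basis" for bs
    using that by (simp add: B_def)
  note lin = linear_iterated_derivative[OF G]
  show "?D 0 x [] = F x" for x by simp
  show "bounded_multilinear_on UNIV (\<bullet>) k (?D k x)" for k x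
  proof -
    have "norm (?D k x vs) \<le> Max (insert 0 ((\<lambda>bs. norm (?D k x bs)) ` B k)) *
        real DIM('e) ^ k * prod_list (map norm vs)" if "length vs = k" for vs
      by (rule multilinear_bound_of_basis_bound[OF _ _ that])
         (auto simp: lin finB Bmem intro!: Max_ge)
    then show ?thesis
      unfolding bounded_multilinear_on_def seminorm_inner
      by (auto simp: linear_add[OF lin] linear_cmul[OF lin])
  qed
  fix k :: nat and x :: 'e and \<epsilon> :: real
  assume "0 < \<epsilon>"
  define R where
    "R h vs = ?D k (x + h) vs - ?D k x vs - ?D (Suc k) x (h # vs)" for h vs
  \<comment> \<open>Expanding in a basis costs a factor \<open>DIM('e) ^ k\<close>, which is paid in advance.\<close>
  define \<epsilon>' where "\<epsilon>' = \<epsilon> / real DIM('e) ^ k"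
  have "0 < \<epsilon>'" using \<open>0 < \<epsilon>\<close> by (simp add: \<epsilon>'_def)
  have "\<forall>\<^sub>F h in nhds 0. \<forall>bs\<in>B k. norm (R h bs) \<le> \<epsilon>' * norm h"
  proof (rule eventually_ball_finite[OF finB], rule ballI)
    fix bs
    obtain d where d: "d > 0" and
      "\<forall>y. norm (y - x) < d \<longrightarrow> norm (?D k y bs - ?D k x bs - ?D (Suc k) x ((y - x) # bs))
           \<le> \<epsilon>' * norm (y - x)"
      using has_derivative_iterated[OF G, of bs x] \<open>0 < \<epsilon>'\<close>
      unfolding has_derivative_at_alt by blast
    then have "norm (R h bs) \<le> \<epsilon>' * norm h" if "norm h < d" for h
      using that by (metis R_def add_diff_cancel_left')
    then show "\<forall>\<^sub>F h in nhds 0. norm (R h bs) \<le> \<epsilon>' * norm h"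
      unfolding eventually_nhds_metric using d by (auto simp: dist_norm)
  qed
  then obtain d where d: "d > 0"
    and small: "\<And>h bs. norm h < d \<Longrightarrow> bs \<in> B k \<Longrightarrow> norm (R h bs) \<le> \<epsilon>' * norm h"
    unfolding eventually_nhds_metric by (auto simp: dist_norm)
  have "norm (R h vs) \<le> \<epsilon> * norm h * prod_list (map norm vs)"
    if h: "norm h < d" and len: "length vs = k" for h vs
  proof -
    have "norm (R h vs) \<le> (\<epsilon>' * norm h) * real DIM('e) ^ k * prod_list (map norm vs)"
    proof (rule multilinear_bound_of_basis_bound[OF _ _ len])
      show "linear (\<lambda>v. R h (us[i := v]))" if "length us = k" "i < k" for us i
        using lin[of "Suc i" "h # us" x] that unfolding R_def
        by (intro linear_compose_sub lin) (simp_all del: iterated_derivative.simps)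
      show "norm (R h us) \<le> \<epsilon>' * norm h" if "length us = k" "set us \<subseteq> Basis" for us
        using small[OF h] Bmem that by blast
    qed
    then show ?thesis by (simp add: \<epsilon>'_def)
  qed
  with d show "\<exists>\<delta>>0. \<forall>h\<in>UNIV. seminorm (\<bullet>) h < \<delta> \<longrightarrow>
      (\<forall>vs. set vs \<subseteq> UNIV \<and> length vs = k \<longrightarrow>
        seminorm (\<bullet>) (?D k (x + h) vs - ?D k x vs - ?D (Suc k) x (h # vs))
          \<le> \<epsilon> * seminorm (\<bullet>) h * prod_list (map (seminorm (\<bullet>)) vs))"
    unfolding seminorm_inner R_def by blast
qed

text \<open>
  A class of scalar functions that is rich enough for the vector fields below and visibly closed
  under directional derivatives.
\<close>

inductive_set elementary :: "('e::real_normed_vector \<Rightarrow> real) set" where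
  linear: "bounded_linear f \<Longrightarrow> f \<in> elementary"
| const: "(\<lambda>x. c) \<in> elementary"
| add: "f \<in> elementary \<Longrightarrow> g \<in> elementary \<Longrightarrow> (\<lambda>x. f x + g x) \<in> elementary"
| mult: "f \<in> elementary \<Longrightarrow> g \<in> elementary \<Longrightarrow> (\<lambda>x. f x * g x) \<in> elementary"
| sin: "f \<in> elementary \<Longrightarrow> (\<lambda>x. sin (f x)) \<in> elementary"
| cos: "f \<in> elementary \<Longrightarrow> (\<lambda>x. cos (f x)) \<in> elementary"
| inverse: "f \<in> elementary \<Longrightarrow> (\<And>x. f x \<noteq> 0) \<Longrightarrow> (\<lambda>x. inverse (f x)) \<in> elementary"

lemma elementary_minus: "f \<in> elementary \<Longrightarrow> (\<lambda>x. - f x) \<in> elementary"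
  using elementary.mult[OF elementary.const[of "-1"], of f] by simp

lemma elementary_has_derivative:
  assumes "f \<in> elementary"
  shows "\<exists>f'. (\<forall>x. (f has_derivative f' x) (at x)) \<and> (\<forall>h. (\<lambda>x. f' x h) \<in> elementary)"
  using assms
proof induction
  case (linear f)
  show ?case
    by (rule exI[of _ "\<lambda>_. f"])
       (auto intro: bounded_linear_imp_has_derivative[OF linear] elementary.const)
next
  case (const c)
  show ?case
    by (rule exI[of _ "\<lambda>_ _. 0"]) (auto intro: elementary.const)
next
  case (add f g)
  then obtain f' g' where
    "\<forall>x. (f has_derivative f' x) (at x)" "\<forall>h. (\<lambda>x. f' x h) \<in> elementary"
    "\<forall>x. (g has_derivative g' x) (at x)" "\<forall>h. (\<lambda>x. g' x h) \<in> elementary" by blast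
  then show ?case
    by (intro exI[of _ "\<lambda>x h. f' x h + g' x h"])
       (auto intro!: has_derivative_add elementary.add)
next
  case (mult f g)
  then obtain f' g' where
    "\<forall>x. (f has_derivative f' x) (at x)" "\<forall>h. (\<lambda>x. f' x h) \<in> elementary"
    "\<forall>x. (g has_derivative g' x) (at x)" "\<forall>h. (\<lambda>x. g' x h) \<in> elementary" by blast
  with mult.hyps show ?case
    by (intro exI[of _ "\<lambda>x h. f x * g' x h + f' x h * g x"])
       (auto intro!: has_derivative_mult elementary.add elementary.mult)
next
  case (sin f)
  then obtain f' where
    "\<forall>x. (f has_derivative f' x) (at x)" "\<forall>h. (\<lambda>x. f' x h) \<in> elementary" by blast
  with sin.hyps show ?case
    by (intro exI[of _ "\<lambda>x h. f' x h * cos (f x)"])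
       (auto intro!: has_derivative_sin elementary.mult elementary.cos)
next
  case (cos f)
  then obtain f' where
    "\<forall>x. (f has_derivative f' x) (at x)" "\<forall>h. (\<lambda>x. f' x h) \<in> elementary" by blast
  with cos.hyps show ?case
    by (intro exI[of _ "\<lambda>x h. f' x h * - sin (f x)"] conjI allI has_derivative_cos
        elementary.mult[OF _ elementary_minus[OF elementary.sin]]) blast+
next
  case (inverse f)
  then obtain f' where
    "\<forall>x. (f has_derivative f' x) (at x)" "\<forall>h. (\<lambda>x. f' x h) \<in> elementary" by blast
  with inverse.hyps show ?case
    by (intro exI[of _ "\<lambda>x h. - (inverse (f x) * f' x h * inverse (f x))"] conjI allI
        Deriv.has_derivative_inverse elementary_minus[OF elementary.mult[OF elementary.mult]]
        elementary.inverse) blast+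
qed

lemma elementary_field_smooth:
  fixes f1 f2 :: "real \<times> real \<Rightarrow> real"
  assumes "f1 \<in> elementary" "f2 \<in> elementary"
  shows "smooth_map UNIV (\<bullet>) (\<lambda>p. (f1 p, f2 p))"
proof (rule smooth_map_if_closed_under_derivatives)
  let ?G = "{\<lambda>p. (f1 p, f2 p) | f1 f2. f1 \<in> elementary \<and> f2 \<in> elementary}
    :: (real \<times> real \<Rightarrow> real \<times> real) set"
  have pair: "f1 \<in> elementary \<Longrightarrow> f2 \<in> elementary \<Longrightarrow> (\<lambda>p. (f1 p, f2 p)) \<in> ?G" for f1 f2
    by blast
  show "(\<lambda>p. (f1 p, f2 p)) \<in> ?G" using assms by (rule pair)
  show "closed_under_derivatives ?G"
    unfolding closed_under_derivatives_def
  proof (rule ballI)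
    fix F assume "F \<in> ?G"
    then obtain f1 f2 where F: "F = (\<lambda>p. (f1 p, f2 p))"
      and f: "f1 \<in> elementary" "f2 \<in> elementary" by blast
    obtain f1' where d1: "\<And>x. (f1 has_derivative f1' x) (at x)"
      and e1: "\<And>h. (\<lambda>x. f1' x h) \<in> elementary"
      using elementary_has_derivative[OF f(1)] by blast
    obtain f2' where d2: "\<And>x. (f2 has_derivative f2' x) (at x)"
      and e2: "\<And>h. (\<lambda>x. f2' x h) \<in> elementary"
      using elementary_has_derivative[OF f(2)] by blast
    have D: "(F has_derivative (\<lambda>h. (f1' x h, f2' x h))) (at x)" for x
      unfolding F by (rule has_derivative_Pair[OF d1 d2])
    have "frechet_derivative F (at x) = (\<lambda>h. (f1' x h, f2' x h))" for x
      by (rule frechet_derivative_at[OF D, symmetric])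
    then have "(\<lambda>x. frechet_derivative F (at x) h) \<in> ?G" for h
      using pair[OF e1 e2] by (simp only:)
    moreover have "F differentiable (at x)" for x
      using D differentiable_def by blast
    ultimately show "(\<forall>x. F differentiable (at x)) \<and> (\<forall>h. (\<lambda>x. frechet_derivative F (at x) h) \<in> ?G)"
      by blast
  qed
qed

section \<open>Copies of a Euclidean space inside the ambient space\<close>

text \<open>
  An injective linear map \<open>\<phi>\<close> makes its range a semi inner product space that is isometric to its
  domain; every vector field and every property of it is carried along.
\<close>

definition transported_inner :: "('e::real_inner \<Rightarrow> 'u) \<Rightarrow> 'u \<Rightarrow> 'u \<Rightarrow> real" where
  "transported_inner \<phi> u v = inv \<phi> u \<bullet> inv \<phi> v"

definition transported_map :: "('e \<Rightarrow> 'u) \<Rightarrow> ('e \<Rightarrow> 'e) \<Rightarrow> 'u \<Rightarrow> 'u" where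
  "transported_map \<phi> F u = \<phi> (F (inv \<phi> u))"

lemma transported_map_apply: "inj \<phi> \<Longrightarrow> transported_map \<phi> F (\<phi> p) = \<phi> (F p)"
  by (simp add: transported_map_def)

lemma seminorm_transported: "inj \<phi> \<Longrightarrow> seminorm (transported_inner \<phi>) (\<phi> p) = norm p"
  by (simp add: seminorm_def transported_inner_def norm_eq_sqrt_inner)

lemma semi_inner_space_transported:
  fixes \<phi> :: "'e::real_inner \<Rightarrow> 'u::real_vector"
  assumes "linear \<phi>" "inj \<phi>"
  shows "semi_inner_space (range \<phi>) (transported_inner \<phi>)"
proof -
  interpret linear \<phi> by fact
  have "subspace (range \<phi>)"
    using assms(1) by (simp add: linear_subspace_image)
  then show ?thesis
    using assms(2) unfolding semi_inner_space_def transported_inner_def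
    by (auto simp: inner_add_left simp flip: add scaleR intro: inner_commute)
qed

lemma list_preimage:
  assumes "set us \<subseteq> range \<phi>"
  obtains vs where "us = map \<phi> vs"
  using assms by (metis ex_map_conv subset_iff rangeE)

lemma smooth_map_transported:
  fixes \<phi> :: "'e::real_inner \<Rightarrow> 'u::real_vector"
  assumes lin: "linear \<phi>" and inj: "inj \<phi>" and smooth: "smooth_map UNIV (\<bullet>) F"
  shows "smooth_map (range \<phi>) (transported_inner \<phi>) (transported_map \<phi> F)"
proof -
  interpret linear \<phi> by (rule lin)
  note norm_eq = seminorm_transported[OF inj]
  have norms: "prod_list (map (seminorm (transported_inner \<phi>)) (map \<phi> vs)) =
      prod_list (map norm vs)" for vs
    by (simp add: norm_eq comp_def)
  have inv_map: "map (inv \<phi>) (map \<phi> vs) = vs" for vs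
    using inj by (simp add: comp_def)
  obtain D :: "nat \<Rightarrow> 'e \<Rightarrow> 'e list \<Rightarrow> 'e" where
      D0: "\<And>x. D 0 x [] = F x"
    and Dk: "\<And>k x. bounded_multilinear_on UNIV (\<bullet>) k (D k x)"
    and Dstep: "\<And>k x \<epsilon>. \<epsilon> > 0 \<Longrightarrow> \<exists>\<delta>>0. \<forall>h. norm h < \<delta> \<longrightarrow> (\<forall>vs. length vs = k \<longrightarrow>
        norm (D k (x + h) vs - D k x vs - D (Suc k) x (h # vs))
          \<le> \<epsilon> * norm h * prod_list (map norm vs))"
    using smooth unfolding smooth_map_def seminorm_inner by auto
  define D' where "D' k x us = \<phi> (D k (inv \<phi> x) (map (inv \<phi>) us))" for k x us
  have D'_apply: "D' k (\<phi> x) (map \<phi> vs) = \<phi> (D k x vs)" for k x vs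
    unfolding D'_def inv_map by (simp add: inj)
  show ?thesis
    unfolding smooth_map_def
  proof (rule exI[of _ D'], intro conjI allI impI ballI)
    show "D' 0 u [] = transported_map \<phi> F u" for u
      by (simp add: D'_def transported_map_def D0)
  next
    fix k u assume "u \<in> range \<phi>"
    then obtain x where u: "u = \<phi> x" by blast
    have update: "D' k u ((map \<phi> vs)[i := \<phi> v]) = \<phi> (D k x (vs[i := v]))" for vs i v
      by (simp only: u D'_apply flip: map_update)
    obtain C where C: "\<And>vs. length vs = k \<Longrightarrow> norm (D k x vs) \<le> C * prod_list (map norm vs)"
      using Dk[of k x] unfolding bounded_multilinear_on_def seminorm_inner by auto
    show "bounded_multilinear_on (range \<phi>) (transported_inner \<phi>) k (D' k u)"
      unfolding bounded_multilinear_on_def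
    proof (intro conjI allI impI ballI; (elim conjE)?)
      fix us :: "'u list" assume us: "set us \<subseteq> range \<phi>"
      obtain vs where vs: "us = map \<phi> vs" using list_preimage[OF us] by blast
      show "D' k u us \<in> range \<phi>" by (simp add: D'_def)
      fix i v w r assume len: "length us = k" "i < k" and "v \<in> range \<phi>" "w \<in> range \<phi>"
      then obtain p q where v: "v = \<phi> p" and w: "w = \<phi> q" by blast
      have mult: "D k x (vs[i := p + q]) = D k x (vs[i := p]) + D k x (vs[i := q])"
        "D k x (vs[i := r *\<^sub>R p]) = r *\<^sub>R D k x (vs[i := p])"
        using Dk[of k x] len vs unfolding bounded_multilinear_on_def by auto
      show "D' k u (us[i := v + w]) = D' k u (us[i := v]) + D' k u (us[i := w])"
        by (simp only: vs v w update mult flip: add)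
      show "D' k u (us[i := r *\<^sub>R v]) = r *\<^sub>R D' k u (us[i := v])"
        by (simp only: vs v update mult flip: scaleR)
    next
      have "seminorm (transported_inner \<phi>) (D' k u us) \<le>
          C * prod_list (map (seminorm (transported_inner \<phi>)) us)"
        if us: "set us \<subseteq> range \<phi>" and len: "length us = k" for us
      proof -
        obtain vs where vs: "us = map \<phi> vs" using list_preimage[OF us] by blast
        show ?thesis unfolding vs norms u D'_apply norm_eq using C len vs by simp
      qed
      then show "\<exists>C. \<forall>us. set us \<subseteq> range \<phi> \<and> length us = k \<longrightarrow>
          seminorm (transported_inner \<phi>) (D' k u us) \<le>
            C * prod_list (map (seminorm (transported_inner \<phi>)) us)" by blast
    qed
  next
    fix k u and \<epsilon> :: real assume "u \<in> range \<phi>" "\<epsilon> > 0"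
    then obtain x where u: "u = \<phi> x" by blast
    obtain d where "d > 0" and d: "\<And>h vs. norm h < d \<Longrightarrow> length vs = k \<Longrightarrow>
        norm (D k (x + h) vs - D k x vs - D (Suc k) x (h # vs))
          \<le> \<epsilon> * norm h * prod_list (map norm vs)"
      using Dstep[OF \<open>\<epsilon> > 0\<close>, of k x] by blast
    have "seminorm (transported_inner \<phi>) (D' k (u + l) us - D' k u us - D' (Suc k) u (l # us))
        \<le> \<epsilon> * seminorm (transported_inner \<phi>) l *
            prod_list (map (seminorm (transported_inner \<phi>)) us)"
      if l: "l \<in> range \<phi>" "seminorm (transported_inner \<phi>) l < d"
        and us: "set us \<subseteq> range \<phi>" and len: "length us = k" for l us
    proof -
      obtain vs where vs: "us = map \<phi> vs" using list_preimage[OF us] by blast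
      obtain h where h: "l = \<phi> h" using l(1) by blast
      have "D' k (u + l) us - D' k u us - D' (Suc k) u (l # us) =
          \<phi> (D k (x + h) vs - D k x vs - D (Suc k) x (h # vs))"
        using D'_apply[of k "x + h" vs] D'_apply[of k x vs] D'_apply[of "Suc k" x "h # vs"]
        by (simp add: u h vs diff add)
      then show ?thesis
        unfolding vs norms using d[of h vs] l(2) len by (simp add: norm_eq h vs)
    qed
    with \<open>d > 0\<close> show "\<exists>\<delta>>0. \<forall>l\<in>range \<phi>. seminorm (transported_inner \<phi>) l < \<delta> \<longrightarrow>
        (\<forall>us. set us \<subseteq> range \<phi> \<and> length us = k \<longrightarrow>
          seminorm (transported_inner \<phi>) (D' k (u + l) us - D' k u us - D' (Suc k) u (l # us))
            \<le> \<epsilon> * seminorm (transported_inner \<phi>) l *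
                prod_list (map (seminorm (transported_inner \<phi>)) us))"
      by blast
  qed
qed

lemma semibounded_transported:
  assumes "inj \<phi>" "\<And>p. p \<bullet> F p \<le> 0"
  shows "semibounded_on (range \<phi>) (transported_inner \<phi>) (transported_map \<phi> F)"
  using assms by (auto simp: semibounded_on_def transported_inner_def transported_map_def)

lemma lip_seminorm_transported_le:
  fixes \<phi> :: "'e::real_inner \<Rightarrow> 'u::real_vector"
  assumes lin: "linear \<phi>" and inj: "inj \<phi>" and "L \<ge> 0"
    and lip: "\<And>p q. norm (F p - F q) \<le> L * norm (p - q)"
  shows "lip_seminorm (range \<phi>) (transported_inner \<phi>) (transported_map \<phi> F) \<le> ennreal L"
  unfolding lip_seminorm_def
proof (rule SUP_least, clarify)
  fix p q assume "\<phi> p \<noteq> \<phi> q"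
  then have pos: "norm (p - q) > 0" by auto
  have "seminorm (transported_inner \<phi>) (transported_map \<phi> F (\<phi> p) - transported_map \<phi> F (\<phi> q)) =
      norm (F p - F q)" "seminorm (transported_inner \<phi>) (\<phi> p - \<phi> q) = norm (p - q)"
    by (simp_all add: transported_map_apply[OF inj] seminorm_transported[OF inj]
        flip: linear_diff[OF lin])
  then show "ennreal (seminorm (transported_inner \<phi>) (transported_map \<phi> F (\<phi> p) - transported_map \<phi> F (\<phi> q)))
      / ennreal (seminorm (transported_inner \<phi>) (\<phi> p - \<phi> q)) \<le> ennreal L"
    using pos lip[of p q] \<open>L \<ge> 0\<close>
    by (simp add: divide_ennreal divide_le_eq)
qed

section \<open>Runge--Kutta steps under linear maps and rescaling of time\<close>

lemma rk_stage_commutes: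
  assumes "linear \<phi>" "\<And>p. g (\<phi> p) = \<phi> (F p)"
  shows "rk_stage a g dt (\<phi> p) i = \<phi> (rk_stage a F dt p i)"
proof (induction i rule: less_induct)
  case (less i)
  interpret linear \<phi> by fact
  show ?case
    by (subst (1 2) rk_stage.simps) (simp add: less assms(2) add scaleR sum)
qed

lemma rk_step_commutes:
  assumes "linear \<phi>" "\<And>p. g (\<phi> p) = \<phi> (F p)"
  shows "rk_step s a b g dt (\<phi> p) = \<phi> (rk_step s a b F dt p)"
proof -
  interpret linear \<phi> by fact
  show ?thesis
    by (simp add: rk_step_def rk_stage_commutes[where \<phi> = \<phi> and g = g and F = F, OF assms]
        assms(2) add scaleR sum)
qed

text \<open>
  Multiplying the field by \<open>c\<close> amounts to multiplying the step size by \<open>c\<close>. Strong stability concerns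
  all small step sizes, so a counterexample with any finite Lipschitz constant can be
  scaled down to any prescribed positive one.
\<close>

lemma rk_stage_rescale_time:
  "rk_stage a (\<lambda>u. c *\<^sub>R g u) dt u0 i = rk_stage a g (c * dt) u0 i"
proof (induction i rule: less_induct)
  case (less i)
  then show ?case
    by (subst (1 2) rk_stage.simps) (simp add: scaleR_sum_right mult_ac)
qed

lemma rk_step_rescale_time:
  "rk_step s a b (\<lambda>u. c *\<^sub>R g u) dt u0 = rk_step s a b g (c * dt) u0"
  by (simp add: rk_step_def rk_stage_rescale_time scaleR_sum_right mult_ac)

definition three_stage_step ::
    "real \<Rightarrow> real \<Rightarrow> real \<Rightarrow> real \<Rightarrow> real \<Rightarrow> real \<Rightarrow> ('u::real_vector \<Rightarrow> 'u) \<Rightarrow> real \<Rightarrow> 'u \<Rightarrow> 'u" where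
  "three_stage_step a21 a31 a32 b1 b2 b3 g t u =
     (let g1 = g u; g2 = g (u + t *\<^sub>R a21 *\<^sub>R g1); g3 = g (u + t *\<^sub>R (a31 *\<^sub>R g1 + a32 *\<^sub>R g2))
      in u + t *\<^sub>R (b1 *\<^sub>R g1 + b2 *\<^sub>R g2 + b3 *\<^sub>R g3))"

text \<open>
  Methods with fewer stages are padded with zero weights; since every stage is determined by the
  earlier ones, the arbitrary entries of \<open>a\<close> in the padding do no harm.
\<close>

lemma second_order_three_stages:
  assumes "explicit_rk s a" "at_least_second_order s a b" "s \<le> 3"
  obtains b1 b2 b3 a21 a31 a32 where
    "b1 + b2 + b3 = 1" "b2 * a21 + b3 * (a31 + a32) = 1 / 2"
    "\<And>(g :: 'u::real_vector \<Rightarrow> 'u) t u. rk_step s a b g t u = three_stage_step a21 a31 a32 b1 b2 b3 g t u"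
proof
  define \<beta> where "\<beta> i = (if i \<le> s then b i else 0)" for i
  have s: "s = 0 \<or> s = 1 \<or> s = 2 \<or> s = 3" using assms(3) by linarith
  have sets: "{1..Suc 0} = {1}" "{1..2::nat} = {1, 2}" "{1..3::nat} = {1, 2, 3}"
    "{1..<2::nat} = {1}" "{1..<3::nat} = {1, 2}" "{Suc 0..<2::nat} = {1}" "{Suc 0..<3::nat} = {1, 2}"
    "{Suc 0..2::nat} = {1, 2}" "{Suc 0..3::nat} = {1, 2, 3}"
    by auto
  show "\<beta> 1 + \<beta> 2 + \<beta> 3 = 1"
    using s assms(2) unfolding at_least_second_order_def \<beta>_def by (elim disjE) (simp_all add: sets)
  show "\<beta> 2 * a 2 1 + \<beta> 3 * (a 3 1 + a 3 2) = 1 / 2"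
    using s assms(1,2) unfolding at_least_second_order_def explicit_rk_def \<beta>_def
    by (elim disjE) (simp_all add: sets algebra_simps)
  fix g :: "'u \<Rightarrow> 'u" and t u
  have stages: "rk_stage a g t u 1 = u" "rk_stage a g t u 2 = u + t *\<^sub>R a 2 1 *\<^sub>R g u"
    "rk_stage a g t u 3 = u + t *\<^sub>R (a 3 1 *\<^sub>R g u + a 3 2 *\<^sub>R g (u + t *\<^sub>R a 2 1 *\<^sub>R g u))"
    by (simp_all add: rk_stage.simps[of a g t u 1] rk_stage.simps[of a g t u 2]
        rk_stage.simps[of a g t u 3] rk_stage.simps[of a g t u "Suc 0"] sets)
  show "rk_step s a b g t u = three_stage_step (a 2 1) (a 3 1) (a 3 2) (\<beta> 1) (\<beta> 2) (\<beta> 3) g t u"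
    using s unfolding rk_step_def three_stage_step_def \<beta>_def Let_def
    by (elim disjE) (simp_all add: sets stages[unfolded One_nat_def] add.assoc)
qed

section \<open>Rotational fields in the plane\<close>

definition quarter_turn :: "real \<times> real \<Rightarrow> real \<times> real" where
  "quarter_turn p = (snd p, - fst p)"

lemma norm_quarter_turn: "norm (quarter_turn p) = norm p"
  by (cases p) (simp add: quarter_turn_def norm_Pair add.commute)

lemma quarter_turn_orthogonal: "p \<bullet> quarter_turn p = 0"
  by (cases p) (simp add: quarter_turn_def)

lemma linear_quarter_turn: "linear quarter_turn"
  by (rule linearI) (simp_all add: quarter_turn_def)

text \<open>
  A rotation with angular speed \<open>\<bar>\<kappa>\<bar>\<close>, perturbed by a field that is bounded if \<open>h\<close> is. Both are
  orthogonal to the position. Far out along the positive second axis the factor of \<open>h\<close> makes the perturbation approach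
  \<open>(h x, 0)\<close>, where \<open>x\<close> is the first coordinate.
\<close>

definition swirl :: "real \<Rightarrow> (real \<Rightarrow> real) \<Rightarrow> real \<times> real \<Rightarrow> real \<times> real" where
  "swirl \<kappa> h p = (\<kappa> + h (fst p) * snd p / (1 + (norm p)\<^sup>2)) *\<^sub>R quarter_turn p"

lemma swirl_orthogonal: "p \<bullet> swirl \<kappa> h p = 0"
  by (simp add: swirl_def quarter_turn_orthogonal)

lemma smooth_swirl:
  assumes h: "(\<lambda>p :: real \<times> real. h (fst p)) \<in> elementary"
  shows "smooth_map UNIV (\<bullet>) (\<lambda>p. c *\<^sub>R swirl \<kappa> h p)"
proof -
  define w where "w p = inverse (1 + (fst p * fst p + snd p * snd p))" for p :: "real \<times> real"
  define f where "f p = \<kappa> + h (fst p) * snd p * w p" for p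
  note intros = elementary.add elementary.mult elementary.const elementary_minus
    elementary.linear[OF bounded_linear_fst] elementary.linear[OF bounded_linear_snd]
  have "1 + (fst p * fst p + snd p * snd p) \<noteq> 0" for p :: "real \<times> real"
    by (smt (verit) zero_le_square)
  then have w: "w \<in> elementary"
    unfolding w_def by (intro elementary.inverse intros)
  have f: "f \<in> elementary"
    unfolding f_def by (intro intros h w)
  have "smooth_map UNIV (\<bullet>) (\<lambda>p. (c * (f p * snd p), c * (- (f p * fst p))))"
    by (intro elementary_field_smooth intros f)
  moreover have "c *\<^sub>R swirl \<kappa> h p = (c * (f p * snd p), c * (- (f p * fst p)))" for p
    by (cases p) (simp add: swirl_def quarter_turn_def f_def w_def norm_Pair divide_inverse
        power2_eq_square)
  ultimately show ?thesis by simp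
qed

text \<open>
  In terms of the bounded Lipschitz map \<open>N p = p / sqrt (1 + |p|\<^sup>2)\<close>, the perturbation in
  \<^const>\<open>swirl\<close> is the product of \<open>h\<close>, a coordinate of \<open>N\<close> and a rotation of \<open>N\<close>, and products of
  bounded Lipschitz maps are Lipschitz.
\<close>

definition soft_normalize :: "'e::real_inner \<Rightarrow> 'e" where
  "soft_normalize p = p /\<^sub>R sqrt (1 + (norm p)\<^sup>2)"

lemma norm_le_sqrt_one_plus: "norm p \<le> sqrt (1 + (norm p)\<^sup>2)"
  by (rule real_le_rsqrt) simp

lemma sqrt_one_plus_ge_1: "1 \<le> sqrt (1 + (norm p)\<^sup>2)"
  by simp

lemma norm_soft_normalize_le: "norm (soft_normalize p) \<le> 1"
proof -
  have "0 < sqrt (1 + (norm p)\<^sup>2)" using sqrt_one_plus_ge_1[of p] by linarith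
  then show ?thesis
    using norm_le_sqrt_one_plus[of p] by (simp add: soft_normalize_def inverse_eq_divide divide_le_eq)
qed

lemma norm_diff_scaleR_le:
  fixes a b :: "'a::real_normed_vector"
  shows "norm (s *\<^sub>R a - s' *\<^sub>R b) \<le> \<bar>s\<bar> * norm (a - b) + \<bar>s - s'\<bar> * norm b"
proof -
  have "s *\<^sub>R a - s' *\<^sub>R b = s *\<^sub>R (a - b) + (s - s') *\<^sub>R b" by (simp add: algebra_simps)
  then show ?thesis by (metis norm_triangle_ineq norm_scaleR)
qed

text \<open>
  The square root is the norm of \<open>(1, p)\<close>, so this is the reverse triangle inequality.
\<close>

lemma sqrt_one_plus_lipschitz:
  fixes p q :: "'e::real_inner"
  shows "\<bar>sqrt (1 + (norm p)\<^sup>2) - sqrt (1 + (norm q)\<^sup>2)\<bar> \<le> norm (p - q)"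
proof -
  have *: "sqrt (1 + (norm p)\<^sup>2) = norm (1::real, p)" for p :: 'e
    by (simp add: norm_Pair)
  show ?thesis
    unfolding * using norm_triangle_ineq3[of "(1::real, p)" "(1, q)"] by (simp add: norm_Pair)
qed

lemma soft_normalize_lipschitz:
  "norm (soft_normalize p - soft_normalize q) \<le> 2 * norm (p - q)"
proof -
  define r where "r = sqrt (1 + (norm p)\<^sup>2)"
  define s where "s = sqrt (1 + (norm q)\<^sup>2)"
  have r: "r \<ge> 1" and s: "s \<ge> 1" "norm q \<le> s" and rs: "\<bar>s - r\<bar> \<le> norm (p - q)"
    using sqrt_one_plus_ge_1 norm_le_sqrt_one_plus[of q] sqrt_one_plus_lipschitz[of q p]
    by (simp_all add: r_def s_def norm_minus_commute)
  have "inverse r - inverse s = (s - r) / (r * s)"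
    using r s by (simp add: field_simps)
  then have "\<bar>inverse r - inverse s\<bar> * norm q = \<bar>s - r\<bar> * (norm q / s) / r"
    using r s by (simp add: abs_mult abs_divide)
  also have "\<dots> \<le> norm (p - q) * 1 / 1"
    using r s rs by (intro frac_le mult_mono) (auto simp: divide_le_eq)
  finally have "\<bar>inverse r - inverse s\<bar> * norm q \<le> norm (p - q)" by simp
  moreover have "\<bar>inverse r\<bar> * norm (p - q) \<le> 1 * norm (p - q)"
    using r by (intro mult_right_mono) (auto simp: inverse_le_1_iff)
  ultimately show ?thesis
    using norm_diff_scaleR_le[of "inverse r" p "inverse s" q]
    unfolding soft_normalize_def r_def s_def by linarith
qed

lemma swirl_lipschitz:
  assumes bound: "\<And>x. \<bar>h x\<bar> \<le> 1" and lip: "\<And>x y. \<bar>h x - h y\<bar> \<le> M * \<bar>x - y\<bar>"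
  shows "norm (swirl \<kappa> h p - swirl \<kappa> h q) \<le> (\<bar>\<kappa>\<bar> + 4 + M) * norm (p - q)"
proof -
  interpret T: linear quarter_turn by (rule linear_quarter_turn)
  define N where "N p = soft_normalize p" for p :: "real \<times> real"
  define f where "f p = h (fst p) * snd (N p)" for p
  have decompose: "swirl \<kappa> h p = \<kappa> *\<^sub>R quarter_turn p + f p *\<^sub>R quarter_turn (N p)" for p
  proof -
    have "sqrt (1 + (norm p)\<^sup>2) * sqrt (1 + (norm p)\<^sup>2) = 1 + (norm p)\<^sup>2"
      by simp
    then show ?thesis
      by (simp add: swirl_def f_def N_def soft_normalize_def T.scaleR scaleR_add_left
          divide_inverse mult_ac flip: inverse_mult_distrib)
  qed
  have "M * \<bar>1 - 0\<bar> \<ge> 0" using lip[of 1 0] by linarith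
  then have M: "M \<ge> 0" by simp
  have coord_le: "\<bar>fst v\<bar> \<le> norm v" "\<bar>snd v\<bar> \<le> norm v" for v :: "real \<times> real"
    using norm_fst_le[of "fst v" "snd v"] norm_snd_le[of "snd v" "fst v"] by simp_all
  have N: "norm (N p) \<le> 1" "norm (N p - N q) \<le> 2 * norm (p - q)" "\<bar>snd (N p)\<bar> \<le> 1" for p q
    using norm_soft_normalize_le[of p] soft_normalize_lipschitz[of p q] coord_le(2)[of "N p"]
    by (auto simp: N_def)
  have snd_diff: "\<bar>snd (N p) - snd (N q)\<bar> \<le> 2 * norm (p - q)"
    using coord_le(2)[of "N p - N q"] N(2)[of p q] by simp
  have h_diff: "\<bar>h (fst p) - h (fst q)\<bar> \<le> M * norm (p - q)"
    using lip[of "fst p" "fst q"] mult_left_mono[OF coord_le(1)[of "p - q"] M] by simp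
  have "\<bar>f p - f q\<bar> \<le> \<bar>h (fst p)\<bar> * \<bar>snd (N p) - snd (N q)\<bar> + \<bar>h (fst p) - h (fst q)\<bar> * \<bar>snd (N q)\<bar>"
    using norm_diff_scaleR_le[of "h (fst p)" "snd (N p)" "h (fst q)" "snd (N q)"] by (simp add: f_def)
  also have "\<dots> \<le> 1 * (2 * norm (p - q)) + (M * norm (p - q)) * 1"
    using bound N(3) snd_diff h_diff M by (intro add_mono mult_mono) auto
  finally have f_diff: "\<bar>f p - f q\<bar> \<le> (2 + M) * norm (p - q)"
    by (simp add: algebra_simps)
  have f_bound: "\<bar>f p\<bar> \<le> 1"
    using mult_mono[OF bound[of "fst p"] N(3)[of p]] by (simp add: f_def abs_mult)
  have "norm (f p *\<^sub>R quarter_turn (N p) - f q *\<^sub>R quarter_turn (N q)) \<le>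
      \<bar>f p\<bar> * norm (N p - N q) + \<bar>f p - f q\<bar> * norm (N q)"
    using norm_diff_scaleR_le[of "f p" "quarter_turn (N p)" "f q" "quarter_turn (N q)"]
    by (simp add: norm_quarter_turn flip: T.diff)
  also have "\<dots> \<le> 1 * (2 * norm (p - q)) + ((2 + M) * norm (p - q)) * 1"
    using f_bound N f_diff M by (intro add_mono mult_mono) auto
  finally have "norm (f p *\<^sub>R quarter_turn (N p) - f q *\<^sub>R quarter_turn (N q)) \<le> (4 + M) * norm (p - q)"
    by (simp add: algebra_simps)
  moreover have "swirl \<kappa> h p - swirl \<kappa> h q = \<kappa> *\<^sub>R quarter_turn (p - q) +
      (f p *\<^sub>R quarter_turn (N p) - f q *\<^sub>R quarter_turn (N q))"
    by (simp add: decompose T.diff algebra_simps)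
  then have "norm (swirl \<kappa> h p - swirl \<kappa> h q) \<le> \<bar>\<kappa>\<bar> * norm (p - q) +
      norm (f p *\<^sub>R quarter_turn (N p) - f q *\<^sub>R quarter_turn (N q))"
    by (metis norm_triangle_ineq norm_scaleR norm_quarter_turn)
  ultimately show ?thesis by (simp add: algebra_simps)
qed

section \<open>Growth of the norm in one step\<close>

text \<open>
  If the slopes \<open>g1\<close>, \<open>g1 + d2\<close>, \<open>g1 + d3\<close> are orthogonal to their stages, the change of energy is a
  quadratic form in the slopes. Second order makes the coefficient of \<open>g1 \<bullet> g1\<close> vanish, so what
  remains is governed by the differences of the slopes.
\<close>

lemma energy_change:
  fixes u g1 d2 d3 :: "'a::real_inner"
  assumes weights: "b1 + b2 + b3 = 1" and order2: "b2 * a21 + b3 * (a31 + a32) = 1 / 2"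
    and orth: "u \<bullet> g1 = 0" "(u + t *\<^sub>R a21 *\<^sub>R g1) \<bullet> (g1 + d2) = 0"
      "(u + t *\<^sub>R (a31 *\<^sub>R g1 + a32 *\<^sub>R (g1 + d2))) \<bullet> (g1 + d3) = 0"
  shows "(norm (u + t *\<^sub>R (b1 *\<^sub>R g1 + b2 *\<^sub>R (g1 + d2) + b3 *\<^sub>R (g1 + d3))))\<^sup>2 - (norm u)\<^sup>2 =
    t\<^sup>2 * (2 * (b2 - b3 * a32 - b2 * a21) * (g1 \<bullet> d2) + 2 * (b3 * (1 - a31 - a32)) * (g1 \<bullet> d3)
      + b2\<^sup>2 * (d2 \<bullet> d2) + 2 * (b2 * b3 - b3 * a32) * (d2 \<bullet> d3) + b3\<^sup>2 * (d3 \<bullet> d3))"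
proof -
  define p q r where "p = g1 \<bullet> g1" and "q = g1 \<bullet> d2" and "r = g1 \<bullet> d3"
  define x y z where "x = d2 \<bullet> d2" and "y = d2 \<bullet> d3" and "z = d3 \<bullet> d3"
  note names = p_def[symmetric] q_def[symmetric] r_def[symmetric] x_def[symmetric]
    y_def[symmetric] z_def[symmetric]
  note comm = inner_commute[of d2 g1] inner_commute[of d3 g1] inner_commute[of d3 d2]
    inner_commute[of g1 u] inner_commute[of d2 u] inner_commute[of d3 u]
  have ud2: "u \<bullet> d2 = - t * a21 * (p + q)"
    using orth(1,2) by (simp add: inner_simps comm names algebra_simps)
  have ud3: "u \<bullet> d3 = - t * ((a31 + a32) * (p + r) + a32 * (q + y))"
    using orth(1,3) by (simp add: inner_simps comm names algebra_simps)
  have b1: "b1 = 1 - b2 - b3" using weights by simp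
  have ba: "b3 * a31 = 1 / 2 - b2 * a21 - b3 * a32" using order2 by (simp add: algebra_simps)
  have "(norm (u + t *\<^sub>R (b1 *\<^sub>R g1 + b2 *\<^sub>R (g1 + d2) + b3 *\<^sub>R (g1 + d3))))\<^sup>2 - (norm u)\<^sup>2 =
    2 * t * (b2 * (u \<bullet> d2) + b3 * (u \<bullet> d3)) +
    t\<^sup>2 * (p + b2\<^sup>2 * x + b3\<^sup>2 * z + 2 * b2 * q + 2 * b3 * r + 2 * b2 * b3 * y)"
  proof -
    have "b1 *\<^sub>R g1 + b2 *\<^sub>R (g1 + d2) + b3 *\<^sub>R (g1 + d3) = g1 + b2 *\<^sub>R d2 + b3 *\<^sub>R d3"
      by (simp add: b1 algebra_simps)
    then show ?thesis
      unfolding power2_norm_eq_inner using orth(1)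
      by (simp only:) (simp add: inner_simps comm names power2_eq_square algebra_simps)
  qed
  also have "\<dots> = t\<^sup>2 * (2 * (b2 - b3 * a32 - b2 * a21) * q + 2 * (b3 * (1 - a31 - a32)) * r
      + b2\<^sup>2 * x + 2 * (b2 * b3 - b3 * a32) * y + b3\<^sup>2 * z)"
    unfolding ud2 ud3 using ba by algebra
  finally show ?thesis by (simp add: names)
qed

text \<open>
  The part of \<open>energy_change\<close> that is linear in the slope differences, to leading order in
  \<open>swirl_energy_growth\<close>: there the nodes are \<open>0\<close>, \<open>a21\<close>, \<open>a31 + a32\<close>, and \<open>h\<close> vanishes at the first one.
\<close>

definition energy_slope ::
    "real \<Rightarrow> real \<Rightarrow> real \<Rightarrow> real \<Rightarrow> real \<Rightarrow> (real \<Rightarrow> real) \<Rightarrow> real" where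
  "energy_slope a21 a31 a32 b2 b3 h =
     (b2 - b3 * a32 - b2 * a21) * h a21 + b3 * (1 - a31 - a32) * h (a31 + a32)"

text \<open>
  The next order, up to a multiple of \<open>\<kappa>\<^sup>2\<close>. The last three terms are the quadratic part of
  \<open>energy_change\<close>; the first one arises because the perturbation at the second stage displaces the
  last stage, where \<open>h\<close> has the derivative \<open>h'\<close>.
\<close>

definition energy_curvature ::
    "real \<Rightarrow> real \<Rightarrow> real \<Rightarrow> real \<Rightarrow> real \<Rightarrow> (real \<Rightarrow> real) \<Rightarrow> real \<Rightarrow> real" where
  "energy_curvature a21 a31 a32 b2 b3 h h' =
     2 * b3 * (1 - a31 - a32) * a32 * h' * h a21
     + b2\<^sup>2 * (h a21)\<^sup>2 + 2 * (b2 * b3 - b3 * a32) * h a21 * h (a31 + a32) + b3\<^sup>2 * (h (a31 + a32))\<^sup>2"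

text \<open>
  The initial value depends on the step size: from \<open>(0, 1 / (\<kappa> t))\<close> the rotation moves the stages by
  order one for every \<open>t\<close>, while the circle through them looks more and more like a straight line.
  So in the limit \<open>t \<rightarrow> 0\<close> the stages have first coordinates \<open>0\<close>, \<open>a21\<close>, \<open>a31 + a32\<close>, and the values of \<open>h\<close> there
  can be prescribed. The change of energy is \<open>t * N t\<close>, where \<open>N\<close> extends differentiably to \<open>t = 0\<close>;
  \<open>N 0\<close> is twice \<open>energy_slope\<close>, and its derivative at \<open>0\<close> is \<open>energy_curvature\<close> plus \<open>\<kappa>\<^sup>2 K\<close> with a
  constant \<open>K\<close> that depends on the method only.
\<close>

lemma swirl_energy_growth:
  fixes h :: "real \<Rightarrow> real"
  assumes weights: "b1 + b2 + b3 = 1" and order2: "b2 * a21 + b3 * (a31 + a32) = 1 / 2"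
    and h0: "h 0 = 0" and deriv: "(h has_real_derivative h') (at (a31 + a32))"
    and grow: "energy_slope a21 a31 a32 b2 b3 h > 0 \<or>
      energy_slope a21 a31 a32 b2 b3 h = 0 \<and> energy_curvature a21 a31 a32 b2 b3 h h' > 0"
  obtains \<kappa> d where "\<kappa> > 0" "d > 0"
    "\<forall>t\<in>{0<..<d}. norm (0 :: real, 1 / (\<kappa> * t)) <
      norm (three_stage_step a21 a31 a32 b1 b2 b3 (swirl \<kappa> h) t (0, 1 / (\<kappa> * t)))"
proof -
  define c3 where "c3 = a31 + a32"
  define m2 where "m2 = b2 - b3 * a32 - b2 * a21"
  define m3 where "m3 = b3 * (1 - a31 - a32)"
  define n where "n = b2 * b3 - b3 * a32"
  define B where "B = energy_curvature a21 a31 a32 b2 b3 h h'"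
  define K where "K = b2\<^sup>2 * a21\<^sup>2 + 2 * n * a21 * c3 + b3\<^sup>2 * c3\<^sup>2 - 2 * m3 * a32 * a21"
  \<comment> \<open>The term \<open>\<kappa>\<^sup>2 K\<close> comes from the rotation itself and may be negative; a slow rotation suffices.\<close>
  have "\<exists>\<kappa>>0. B > 0 \<longrightarrow> B + \<kappa>\<^sup>2 * K > 0"
  proof (cases "B > 0")
    case True
    define \<kappa> where "\<kappa> = sqrt (B / (2 * (\<bar>K\<bar> + 1)))"
    have "\<kappa>\<^sup>2 * \<bar>K\<bar> = B * (\<bar>K\<bar> / (2 * (\<bar>K\<bar> + 1)))"
      using True by (simp add: \<kappa>_def)
    also have "\<dots> < B * 1"
      using True by (intro mult_strict_left_mono) (auto simp: divide_less_eq)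
    finally have "\<bar>\<kappa>\<^sup>2 * K\<bar> < B" by (simp add: abs_mult)
    then have "B + \<kappa>\<^sup>2 * K > 0" by linarith
    moreover have "\<kappa> > 0" using True by (simp add: \<kappa>_def)
    ultimately show ?thesis by blast
  qed (auto intro: exI[of _ 1])
  then obtain \<kappa> where \<kappa>: "\<kappa> > 0" and small: "B > 0 \<Longrightarrow> B + \<kappa>\<^sup>2 * K > 0" by blast

  \<comment> \<open>The slopes are \<open>(1 / t + x2 t, y2 t)\<close> and \<open>(1 / t + x3 t, y3 t)\<close>, and the last stage is
    \<open>(X t, Y t / (\<kappa> t))\<close>; in this scaling all functions make sense at \<open>t = 0\<close>.\<close>
  define x2 where "x2 t = h a21 / (\<kappa>\<^sup>2 * t\<^sup>2 * (1 + a21\<^sup>2) + 1)" for t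
  define y2 where "y2 t = - a21 * (\<kappa> + \<kappa> * t * x2 t)" for t
  define X where "X t = c3 + t * a32 * x2 t" for t
  define Y where "Y t = 1 + \<kappa> * t\<^sup>2 * a32 * y2 t" for t
  define D where "D t = \<kappa>\<^sup>2 * t\<^sup>2 * (1 + (X t)\<^sup>2) + (Y t)\<^sup>2" for t
  define x3 where "x3 t = \<kappa> * t * a32 * y2 t + h (X t) * (Y t)\<^sup>2 / D t" for t
  define y3 where "y3 t = - (\<kappa> + h (X t) * \<kappa> * t * Y t / D t) * X t" for t
  define Q where "Q t = b2\<^sup>2 * ((x2 t)\<^sup>2 + (y2 t)\<^sup>2) + 2 * n * (x2 t * x3 t + y2 t * y3 t)
      + b3\<^sup>2 * ((x3 t)\<^sup>2 + (y3 t)\<^sup>2)" for t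
  define N where "N t = 2 * (m2 * x2 t + m3 * x3 t) + t * Q t" for t

  have energy: "(norm (three_stage_step a21 a31 a32 b1 b2 b3 (swirl \<kappa> h) t (0, 1 / (\<kappa> * t))))\<^sup>2
      - (norm (0 :: real, 1 / (\<kappa> * t)))\<^sup>2 = t * N t" if t: "t > 0" for t
  proof -
    define u :: "real \<times> real" where "u = (0, 1 / (\<kappa> * t))"
    define g1 :: "real \<times> real" where "g1 = (1 / t, 0)"
    define d2 where "d2 = (x2 t, y2 t)"
    define d3 where "d3 = (x3 t, y3 t)"
    have pos: "\<kappa>\<^sup>2 * t\<^sup>2 * (1 + c\<^sup>2) > 0" for c :: real
      using \<kappa> t by (intro mult_pos_pos) (auto simp: add_pos_nonneg)
    have "D t > 0"
      unfolding D_def by (intro add_pos_nonneg pos) simp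
    have D2: "\<kappa>\<^sup>2 * t\<^sup>2 * (1 + a21\<^sup>2) + 1 > 0"
      using pos[of a21] by linarith
    have swirl_at: "swirl \<kappa> h (x, Z / (\<kappa> * t)) =
        (Z / t + h x * Z\<^sup>2 / (\<kappa>\<^sup>2 * t\<^sup>2 * (1 + x\<^sup>2) + Z\<^sup>2),
         - (\<kappa> + h x * \<kappa> * t * Z / (\<kappa>\<^sup>2 * t\<^sup>2 * (1 + x\<^sup>2) + Z\<^sup>2)) * x)" for x Z
    proof -
      define E where "E = \<kappa>\<^sup>2 * t\<^sup>2 * (1 + x\<^sup>2) + Z\<^sup>2"
      have "E > 0" unfolding E_def by (intro add_pos_nonneg pos) simp
      have "1 + (norm (x, Z / (\<kappa> * t)))\<^sup>2 = E / (\<kappa> * t)\<^sup>2"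
        using \<kappa> t by (simp add: E_def norm_Pair field_simps)
      then have factor: "(Z / (\<kappa> * t)) / (1 + (norm (x, Z / (\<kappa> * t)))\<^sup>2) = \<kappa> * t * Z / E"
        using \<kappa> t \<open>E > 0\<close> by (simp only:) (simp add: power2_eq_square)
      then show ?thesis
        using \<kappa> t \<open>E > 0\<close> unfolding E_def[symmetric]
        unfolding swirl_def quarter_turn_def fst_conv snd_conv factor times_divide_eq_right[symmetric]
        by (simp add: power2_eq_square field_simps)
    qed
    have g1: "swirl \<kappa> h u = g1"
      using swirl_at[of 0 1] by (simp add: u_def g1_def h0)
    have u2: "u + t *\<^sub>R a21 *\<^sub>R g1 = (a21, 1 / (\<kappa> * t))"
      using t by (simp add: u_def g1_def)
    have g2: "swirl \<kappa> h (u + t *\<^sub>R a21 *\<^sub>R g1) = g1 + d2"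
      unfolding u2 swirl_at by (simp add: g1_def d2_def x2_def y2_def algebra_simps)
    have u3: "u + t *\<^sub>R (a31 *\<^sub>R g1 + a32 *\<^sub>R (g1 + d2)) = (X t, Y t / (\<kappa> * t))"
      using t \<kappa> by (simp add: u_def g1_def d2_def X_def Y_def c3_def field_simps power2_eq_square)
    have "Y t / t = 1 / t + \<kappa> * t * a32 * y2 t"
      using t by (simp add: Y_def field_simps power2_eq_square)
    then have g3: "swirl \<kappa> h (u + t *\<^sub>R (a31 *\<^sub>R g1 + a32 *\<^sub>R (g1 + d2))) = g1 + d3"
      unfolding u3 swirl_at D_def[symmetric] by (simp add: g1_def d3_def x3_def y3_def)
    have step: "three_stage_step a21 a31 a32 b1 b2 b3 (swirl \<kappa> h) t u =
        u + t *\<^sub>R (b1 *\<^sub>R g1 + b2 *\<^sub>R (g1 + d2) + b3 *\<^sub>R (g1 + d3))"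
      unfolding three_stage_step_def Let_def g1 g2 g3 ..
    have "(norm (three_stage_step a21 a31 a32 b1 b2 b3 (swirl \<kappa> h) t u))\<^sup>2 - (norm u)\<^sup>2 =
        t\<^sup>2 * (2 * m2 * (g1 \<bullet> d2) + 2 * m3 * (g1 \<bullet> d3)
          + b2\<^sup>2 * (d2 \<bullet> d2) + 2 * n * (d2 \<bullet> d3) + b3\<^sup>2 * (d3 \<bullet> d3))"
      unfolding step m2_def m3_def n_def
      by (intro energy_change weights order2; metis swirl_orthogonal g1 g2 g3)
    also have "\<dots> = t * N t"
      using t by (simp add: g1_def d2_def d3_def N_def Q_def field_simps power2_eq_square)
    finally show ?thesis by (simp only: u_def)
  qed

  have at0: "x2 0 = h a21" "y2 0 = - \<kappa> * a21" "X 0 = c3" "Y 0 = 1" "D 0 = 1" "x3 0 = h c3"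
      "y3 0 = - \<kappa> * c3"
    by (simp_all add: x2_def y2_def X_def Y_def D_def x3_def y3_def)
  have dx2: "(x2 has_real_derivative 0) (at 0)"
    unfolding x2_def by (auto intro!: derivative_eq_intros)
  have "\<exists>c. (y2 has_real_derivative c) (at 0)"
    unfolding y2_def by (rule exI) (auto intro!: derivative_eq_intros dx2)
  then obtain y2' where dy2: "(y2 has_real_derivative y2') (at 0)" ..
  have dX: "(X has_real_derivative a32 * h a21) (at 0)"
    unfolding X_def by (auto intro!: derivative_eq_intros dx2 simp: at0)
  have dY: "(Y has_real_derivative 0) (at 0)"
    unfolding Y_def by (auto intro!: derivative_eq_intros dy2)
  have dD: "(D has_real_derivative 0) (at 0)"
    unfolding D_def by (auto intro!: derivative_eq_intros dX dY)
  have "(h has_real_derivative h') (at (X 0))"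
    using deriv by (simp add: at0 c3_def)
  from DERIV_chain2[OF this dX]
  have dhX: "((\<lambda>t. h (X t)) has_real_derivative h' * (a32 * h a21)) (at 0)" .
  have dx3: "(x3 has_real_derivative h' * (a32 * h a21) - \<kappa>\<^sup>2 * a32 * a21) (at 0)"
    unfolding x3_def
    by (auto intro!: derivative_eq_intros dy2 dhX dY dD simp: at0 power2_eq_square)
  have "\<exists>c. (y3 has_real_derivative c) (at 0)"
    unfolding y3_def by (rule exI) (auto intro!: derivative_eq_intros dX dhX dY dD simp: at0)
  then obtain y3' where dy3: "(y3 has_real_derivative y3') (at 0)" ..
  have "\<exists>c. (Q has_real_derivative c) (at 0)"
    unfolding Q_def by (rule exI) (auto intro!: derivative_eq_intros dx2 dy2 dx3 dy3)
  then obtain Q' where dQ: "(Q has_real_derivative Q') (at 0)" ..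
  have "(N has_real_derivative 2 * m3 * (h' * (a32 * h a21) - \<kappa>\<^sup>2 * a32 * a21) + Q 0) (at 0)"
    unfolding N_def by (auto intro!: derivative_eq_intros dx2 dx3 dQ)
  moreover have "2 * m3 * (h' * (a32 * h a21) - \<kappa>\<^sup>2 * a32 * a21) + Q 0 = B + \<kappa>\<^sup>2 * K"
    by (simp add: Q_def at0 B_def energy_curvature_def K_def m3_def n_def c3_def
        algebra_simps power2_eq_square)
  ultimately have dN: "(N has_real_derivative B + \<kappa>\<^sup>2 * K) (at 0)" by simp
  have N0: "N 0 = 2 * energy_slope a21 a31 a32 b2 b3 h"
    by (simp add: N_def at0 energy_slope_def m2_def m3_def c3_def)
  have "\<exists>d>0. \<forall>t. 0 < t \<longrightarrow> t < d \<longrightarrow> 0 < N t"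
    using grow
  proof
    assume "energy_slope a21 a31 a32 b2 b3 h > 0"
    then have "N 0 > 0" by (simp add: N0)
    with DERIV_isCont[OF dN] have "\<forall>\<^sub>F t in at 0. 0 < N t"
      unfolding isCont_def by (rule order_tendstoD(1))
    then show ?thesis
      unfolding eventually_at by (auto simp: dist_real_def)
  next
    assume "energy_slope a21 a31 a32 b2 b3 h = 0 \<and> energy_curvature a21 a31 a32 b2 b3 h h' > 0"
    then show ?thesis
      using DERIV_pos_inc_right[OF dN] small N0 by (auto simp: B_def)
  qed
  then obtain d where d: "d > 0" "\<And>t. 0 < t \<Longrightarrow> t < d \<Longrightarrow> 0 < N t" by blast
  have "norm (0 :: real, 1 / (\<kappa> * t)) <
      norm (three_stage_step a21 a31 a32 b1 b2 b3 (swirl \<kappa> h) t (0, 1 / (\<kappa> * t)))"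
    if t: "0 < t" "t < d" for t
  proof (rule power2_less_imp_less)
    show "(norm (0 :: real, 1 / (\<kappa> * t)))\<^sup>2 <
        (norm (three_stage_step a21 a31 a32 b1 b2 b3 (swirl \<kappa> h) t (0, 1 / (\<kappa> * t))))\<^sup>2"
      using energy[OF t(1)] mult_pos_pos[OF t(1) d(2)[OF t]] by linarith
  qed simp
  then show thesis using that \<kappa> d(1) by simp
qed

section \<open>Choice of the perturbation\<close>

text \<open>
  A bounded function with zeros at \<open>0\<close> and \<open>q\<close>; the zero at \<open>0\<close> is double if \<open>q = 0\<close>. If \<open>\<omega>\<close> is small, it
  vanishes at no other node of the method.
\<close>

definition profile :: "real \<Rightarrow> real \<Rightarrow> real \<Rightarrow> real \<Rightarrow> real" where
  "profile \<sigma> \<omega> q x = \<sigma> * (sin (\<omega> * x) * sin (\<omega> * (x - q)))"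

definition profile_deriv :: "real \<Rightarrow> real \<Rightarrow> real \<Rightarrow> real \<Rightarrow> real" where
  "profile_deriv \<sigma> \<omega> q x =
     \<sigma> * \<omega> * (cos (\<omega> * x) * sin (\<omega> * (x - q)) + sin (\<omega> * x) * cos (\<omega> * (x - q)))"

lemma has_derivative_profile:
  "(profile \<sigma> \<omega> q has_real_derivative profile_deriv \<sigma> \<omega> q x) (at x)"
  unfolding profile_def profile_deriv_def
  by (auto intro!: derivative_eq_intros simp: algebra_simps)

lemma profile_bounded: "\<bar>\<sigma>\<bar> \<le> 1 \<Longrightarrow> \<bar>profile \<sigma> \<omega> q x\<bar> \<le> 1"
  unfolding profile_def abs_mult by (intro mult_le_one mult_nonneg_nonneg) auto

lemma profile_lipschitz:
  assumes "\<bar>\<sigma>\<bar> \<le> 1" "\<omega> \<ge> 0"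
  shows "\<bar>profile \<sigma> \<omega> q x - profile \<sigma> \<omega> q y\<bar> \<le> (2 * \<omega>) * \<bar>x - y\<bar>"
proof -
  have bound: "\<bar>profile_deriv \<sigma> \<omega> q z\<bar> \<le> 2 * \<omega>" for z
  proof -
    have "\<bar>cos (\<omega> * z) * sin (\<omega> * (z - q)) + sin (\<omega> * z) * cos (\<omega> * (z - q))\<bar> =
        \<bar>sin (\<omega> * z + \<omega> * (z - q))\<bar>"
      by (simp add: sin_add add.commute)
    also have "\<dots> \<le> 2"
      using abs_sin_le_one[of "\<omega> * z + \<omega> * (z - q)"] by linarith
    finally have "\<bar>\<sigma>\<bar> * \<omega> * \<bar>cos (\<omega> * z) * sin (\<omega> * (z - q)) + sin (\<omega> * z) * cos (\<omega> * (z - q))\<bar>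
        \<le> (1 * \<omega>) * 2"
      using assms by (intro mult_mono) auto
    then show ?thesis
      using assms by (simp add: profile_deriv_def abs_mult)
  qed
  show ?thesis
    using field_differentiable_bound[of UNIV "profile \<sigma> \<omega> q" "profile_deriv \<sigma> \<omega> q" "2 * \<omega>" x y]
      has_derivative_profile bound by (simp add: real_norm_def)
qed

text \<open>
  If \<open>energy_slope\<close> is nonzero for some profile, the sign of the profile decides. Otherwise suppose that
  the nodes \<open>0\<close>, \<open>a21\<close>, \<open>a31 + a32\<close> are distinct. Then the coefficients of \<open>energy_slope\<close> vanish, and for a
  profile that is nonzero only at the node \<open>c\<close> of one stage, with weight \<open>b\<close>, the whole of
  \<open>energy_curvature\<close> is \<open>b\<^sup>2 (h c)\<^sup>2\<close>; some stage after the first has nonzero weight by second order.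
  Nodes that coincide need more care, because then the displacement of the last stage may contribute
  through the derivative of the profile.
\<close>

lemma exists_growing_profile:
  assumes order2: "b2 * a21 + b3 * (a31 + a32) = 1 / 2"
  obtains \<sigma> \<omega> q where "\<bar>\<sigma>\<bar> = 1" "\<omega> > 0"
    "energy_slope a21 a31 a32 b2 b3 (profile \<sigma> \<omega> q) > 0 \<or>
     energy_slope a21 a31 a32 b2 b3 (profile \<sigma> \<omega> q) = 0 \<and>
     energy_curvature a21 a31 a32 b2 b3 (profile \<sigma> \<omega> q) (profile_deriv \<sigma> \<omega> q (a31 + a32)) > 0"
proof -
  define c3 where "c3 = a31 + a32"
  define m2 where "m2 = b2 - b3 * a32 - b2 * a21"
  define m3 where "m3 = b3 * (1 - c3)"
  define \<omega> where "\<omega> = 1 / (\<bar>a21\<bar> + \<bar>c3\<bar> + 1)"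
  let ?h = "\<lambda>q. profile 1 \<omega> q" and ?h' = "\<lambda>q. profile_deriv 1 \<omega> q c3"
  let ?A = "\<lambda>q. energy_slope a21 a31 a32 b2 b3 (?h q)"
  let ?B = "\<lambda>q. energy_curvature a21 a31 a32 b2 b3 (?h q) (?h' q)"
  have "\<omega> > 0" by (simp add: \<omega>_def add_nonneg_pos)
  have order2': "b2 * a21 + b3 * c3 = 1 / 2" using order2 by (simp add: c3_def)
  have A: "?A q = m2 * ?h q a21 + m3 * ?h q c3" for q
    by (simp add: energy_slope_def m2_def m3_def c3_def algebra_simps)
  have B: "?B q = 2 * m3 * a32 * ?h' q * ?h q a21 + b2\<^sup>2 * (?h q a21)\<^sup>2
      + 2 * (b2 * b3 - b3 * a32) * ?h q a21 * ?h q c3 + b3\<^sup>2 * (?h q c3)\<^sup>2" for q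
    by (simp add: energy_curvature_def m3_def c3_def algebra_simps)
  have small: "\<bar>\<omega> * x\<bar> < 1" if "\<bar>x\<bar> \<le> \<bar>a21\<bar> + \<bar>c3\<bar>" for x
  proof -
    have "0 < \<bar>a21\<bar> + \<bar>c3\<bar> + 1" by linarith
    with that show ?thesis by (simp add: \<omega>_def abs_divide divide_less_eq)
  qed
  have sin_nz: "sin (\<omega> * x) \<noteq> 0" if "x \<noteq> 0" "\<bar>x\<bar> \<le> \<bar>a21\<bar> + \<bar>c3\<bar>" for x
    using sin_eq_0_pi[of "\<omega> * x"] small[OF that(2)] that(1) \<open>\<omega> > 0\<close> pi_gt3
    by (auto simp: abs_less_iff)
  have h_nz: "?h q x \<noteq> 0"
    if "x \<noteq> 0" "x \<noteq> q" "\<bar>x\<bar> \<le> \<bar>a21\<bar> + \<bar>c3\<bar>" "\<bar>x - q\<bar> \<le> \<bar>a21\<bar> + \<bar>c3\<bar>" for q x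
    using sin_nz[of x] sin_nz[of "x - q"] that by (simp add: profile_def)
  have h_0: "?h q 0 = 0" "?h q q = 0" for q
    by (simp_all add: profile_def)
  have "\<exists>q. ?A q \<noteq> 0 \<or> ?B q > 0"
  proof -
    \<comment> \<open>The nodes \<open>a21\<close> and \<open>c3\<close> are not both \<open>0\<close> for a method of second order.\<close>
    consider (distinct) "a21 \<noteq> 0" "c3 \<noteq> 0" "a21 \<noteq> c3" | (third) "c3 = 0" "a21 \<noteq> 0"
      | (second) "a21 = 0" "c3 \<noteq> 0" | (equal) "a21 = c3" "c3 \<noteq> 0"
      using order2' by fastforce
    then show ?thesis
    proof cases
      case distinct
      have h2: "?h c3 a21 \<noteq> 0" and h3: "?h a21 c3 \<noteq> 0"
        by (intro h_nz; use distinct in arith)+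
      show ?thesis
      proof (cases "m2 = 0 \<and> m3 = 0")
        case True
        show ?thesis
        proof (cases "b2 = 0")
          case False
          then have "?B c3 > 0" using True h2 unfolding B by (simp add: h_0)
          then show ?thesis by blast
        next
          case b2: True
          with order2' have "b3 \<noteq> 0" by auto
          then have "?B a21 > 0" using True h3 unfolding B by (simp add: b2 h_0)
          then show ?thesis by blast
        qed
      next
        case False
        then have "?A c3 \<noteq> 0 \<or> ?A a21 \<noteq> 0" using h2 h3 by (auto simp: A h_0)
        then show ?thesis by blast
      qed
    next
      case third
      have "?h 0 a21 \<noteq> 0" by (intro h_nz; use third in arith)
      \<comment> \<open>The last stage returns to the node of the first one; the double zero removes its drift.\<close>
      moreover have "?h' 0 = 0" using third by (simp add: profile_deriv_def)
      moreover have "b2 \<noteq> 0" using order2' third by auto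
      ultimately have "?B 0 > 0" using third unfolding B by (simp add: h_0)
      then show ?thesis by blast
    next
      case second
      have "?h 0 c3 \<noteq> 0" by (intro h_nz; use second in arith)
      moreover have "b3 \<noteq> 0" using order2' second by auto
      ultimately have "?B 0 > 0" using second unfolding B by (simp add: h_0)
      then show ?thesis by blast
    next
      case equal
      define s where "s = sin (\<omega> * c3)"
      define k where "k = cos (\<omega> * c3)"
      have hc: "?h 0 c3 = s\<^sup>2" by (simp add: profile_def s_def power2_eq_square)
      have h'c: "?h' 0 = 2 * \<omega> * k * s" by (simp add: profile_deriv_def s_def k_def)
      have "s \<noteq> 0" using sin_nz[of c3] equal by (simp add: s_def)
      have "k > 0"
        unfolding k_def using small[of c3] pi_gt3 by (intro cos_gt_zero_pi) auto
      \<comment> \<open>The drift term below has the sign of \<open>s / c3\<close>, positive for nodes on either side of \<open>0\<close>.\<close>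
      have sc: "s / c3 > 0"
      proof (cases "c3 > 0")
        case True
        then have "s > 0"
          unfolding s_def using small[of c3] pi_gt3 \<open>\<omega> > 0\<close> by (intro sin_gt_zero) auto
        with True show ?thesis by simp
      next
        case False
        with equal have "c3 < 0" by simp
        then have "sin (\<omega> * (- c3)) > 0"
          using small[of "- c3"] pi_gt3 \<open>\<omega> > 0\<close>
          by (intro sin_gt_zero) (auto simp: mult_pos_neg)
        then have "s < 0" by (simp add: s_def)
        with \<open>c3 < 0\<close> show ?thesis by (simp add: divide_neg_neg)
      qed
      show ?thesis
      proof (cases "m2 + m3 = 0")
        case False
        then have "?A 0 \<noteq> 0"
          unfolding A using equal hc \<open>s \<noteq> 0\<close> by (simp flip: distrib_right)
        then show ?thesis by blast
      next
        case True
        \<comment> \<open>Second order and \<open>m2 + m3 = 0\<close> determine everything that enters the curvature in terms of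
          the node; the result is a sum of two nonnegative terms without a common zero.\<close>
        have sum: "b2 + b3 = 1 / (2 * c3)"
          using order2' equal by (simp add: field_simps)
        have b3a32: "b3 * a32 = (1 - c3) / (2 * c3)"
        proof -
          have "b3 * a32 = (b2 + b3) * (1 - c3)"
            using True equal(1) unfolding m2_def m3_def by algebra
          also have "\<dots> = 1 / (2 * c3) * (1 - c3)" by (simp only: sum)
          finally show ?thesis by simp
        qed
        have "?B 0 = 2 * (1 - c3) * (b3 * a32) * (2 * \<omega> * k * s) * s\<^sup>2
            + ((b2 + b3)\<^sup>2 - 2 * (b3 * a32)) * s ^ 4"
          unfolding B by (simp add: equal hc h'c m3_def power2_eq_square power4_eq_xxxx algebra_simps)
        also have "\<dots> = 2 * (1 - c3)\<^sup>2 * \<omega> * k * (s / c3) * s\<^sup>2 + (1 / (2 * c3) - 1)\<^sup>2 * s ^ 4"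
          unfolding sum b3a32 using equal by (simp add: field_simps power2_eq_square)
        also have "\<dots> > 0"
        proof (cases "c3 = 1")
          case True
          then show ?thesis using \<open>s \<noteq> 0\<close> by (simp add: power2_eq_square)
        next
          case False
          then have "0 < 2 * (1 - c3)\<^sup>2 * \<omega> * k * (s / c3) * s\<^sup>2"
            using \<open>\<omega> > 0\<close> \<open>k > 0\<close> \<open>s \<noteq> 0\<close> sc by (intro mult_pos_pos) auto
          then show ?thesis by (intro add_pos_nonneg) auto
        qed
        finally show ?thesis by blast
      qed
    qed
  qed
  then obtain q where q: "?A q \<noteq> 0 \<or> ?B q > 0" by blast
  show thesis
  proof (cases "?A q < 0")
    case True
    have "energy_slope a21 a31 a32 b2 b3 (profile (- 1) \<omega> q) = - ?A q"
      by (simp add: energy_slope_def profile_def)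
    with True \<open>\<omega> > 0\<close> show thesis by (intro that[of "- 1" \<omega> q]) auto
  next
    case False
    with q \<open>\<omega> > 0\<close> show thesis by (intro that[of 1 \<omega> q]) (auto simp: c3_def)
  qed
qed

section \<open>Nonexistence of the methods\<close>

lemma exists_coordinate_plane:
  assumes "large_ambient TYPE('u::real_vector)"
  obtains \<phi> :: "real \<times> real \<Rightarrow> 'u::real_vector" where "linear \<phi>" "inj \<phi>"
proof -
  obtain e :: "real \<Rightarrow> 'u" where e: "inj e" "independent (range e)"
    using assms by (auto simp: large_ambient_def)
  have ind: "independent {e 0, e 1}"
    by (rule independent_mono[OF e(2)]) auto
  have ne: "e 0 \<noteq> e 1" using e(1) by (metis injD zero_neq_one)
  define \<phi> where "\<phi> p = fst p *\<^sub>R e 0 + snd p *\<^sub>R e 1" for p :: "real \<times> real"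
  have lin: "linear \<phi>"
    by (rule linearI) (simp_all add: \<phi>_def algebra_simps)
  have "p = 0" if "\<phi> p = 0" for p
  proof -
    define c where "c v = (if v = e 0 then fst p else snd p)" for v
    have "(\<Sum>v\<in>{e 0, e 1}. c v *\<^sub>R v) = 0"
      using that ne by (simp add: \<phi>_def c_def)
    then have "c (e 0) = 0" "c (e 1) = 0"
      using independentD[OF ind, of "{e 0, e 1}" c] by auto
    with ne show "p = 0" by (simp add: c_def prod_eq_iff)
  qed
  then have "inj \<phi>" using linear_injective_0[OF lin] by blast
  with lin show thesis using that by blast
qed

theorem theorem3p3:
  fixes L :: real
  assumes "L > 0"
    and "large_ambient TYPE('u::real_vector)"
  shows "\<not> (\<exists>(s::nat) (a :: nat \<Rightarrow> nat \<Rightarrow> real) (b :: nat \<Rightarrow> real).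
    explicit_rk s a \<and>
    (\<exists>c>0. strong_stability_preserving TYPE('u) s a b c) \<and>
    at_least_second_order s a b \<and> s \<le> 3 \<and>
    (\<forall>(V :: 'u set) ip g.
       semi_inner_space V ip \<and> g \<in> V \<rightarrow> V \<and> smooth_map V ip g \<and>
       semibounded_on V ip g \<and> lip_seminorm V ip g \<le> ennreal L
       \<longrightarrow> strongly_stable s a b V ip g))"
proof (rule notI, elim exE conjE)
  fix s :: nat and a :: "nat \<Rightarrow> nat \<Rightarrow> real" and b :: "nat \<Rightarrow> real"
  assume rk: "explicit_rk s a" "at_least_second_order s a b" "s \<le> 3"
    and stable: "\<forall>(V :: 'u set) ip g.
       semi_inner_space V ip \<and> g \<in> V \<rightarrow> V \<and> smooth_map V ip g \<and>
       semibounded_on V ip g \<and> lip_seminorm V ip g \<le> ennreal L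
       \<longrightarrow> strongly_stable s a b V ip g"
  obtain b1 b2 b3 a21 a31 a32 where
      weights: "b1 + b2 + b3 = 1" and order2: "b2 * a21 + b3 * (a31 + a32) = 1 / 2"
    and step: "\<And>(g :: real \<times> real \<Rightarrow> real \<times> real) t u.
      rk_step s a b g t u = three_stage_step a21 a31 a32 b1 b2 b3 g t u"
    by (rule second_order_three_stages[OF rk, where 'u = "real \<times> real"])
      (rule that; simp)
  obtain \<sigma> \<omega> q where \<sigma>: "\<bar>\<sigma>\<bar> = 1" and "\<omega> > 0" and grow:
    "energy_slope a21 a31 a32 b2 b3 (profile \<sigma> \<omega> q) > 0 \<or>
     energy_slope a21 a31 a32 b2 b3 (profile \<sigma> \<omega> q) = 0 \<and>
     energy_curvature a21 a31 a32 b2 b3 (profile \<sigma> \<omega> q) (profile_deriv \<sigma> \<omega> q (a31 + a32)) > 0"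
    by (rule exists_growing_profile[OF order2])
  define h where "h = profile \<sigma> \<omega> q"
  have "h 0 = 0" by (simp add: h_def profile_def)
  note growth_rule = swirl_energy_growth[OF weights order2 this
      has_derivative_profile[of \<sigma> \<omega> q, folded h_def] grow[folded h_def]]
  obtain \<kappa> d where "\<kappa> > 0" "d > 0" and growth:
    "\<forall>t\<in>{0<..<d}. norm (0 :: real, 1 / (\<kappa> * t)) <
      norm (three_stage_step a21 a31 a32 b1 b2 b3 (swirl \<kappa> h) t (0, 1 / (\<kappa> * t)))"
    by (rule growth_rule)
  define \<Lambda> where "\<Lambda> = \<bar>\<kappa>\<bar> + 4 + 2 * \<omega>"
  have lip: "norm (swirl \<kappa> h x - swirl \<kappa> h y) \<le> \<Lambda> * norm (x - y)" for x y
    unfolding \<Lambda>_def h_def using \<sigma> \<open>\<omega> > 0\<close>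
    by (intro swirl_lipschitz profile_bounded profile_lipschitz) auto
  have "\<Lambda> > 0" using \<open>\<omega> > 0\<close> by (simp add: \<Lambda>_def)
  define c where "c = L / \<Lambda>"
  have "c > 0" using \<open>\<Lambda> > 0\<close> \<open>L > 0\<close> by (simp add: c_def)
  define F where "F p = c *\<^sub>R swirl \<kappa> h p" for p
  obtain \<phi> :: "real \<times> real \<Rightarrow> 'u" where \<phi>: "linear \<phi>" "inj \<phi>"
    by (rule exists_coordinate_plane[OF assms(2)])
  have "(\<lambda>p :: real \<times> real. h (fst p)) \<in> elementary"
  proof -
    have "(\<lambda>p :: real \<times> real. \<sigma> * (sin (\<omega> * fst p) * sin (\<omega> * (fst p + - q)))) \<in> elementary"
      by (intro elementary.mult elementary.sin elementary.add elementary.const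
          elementary.linear[OF bounded_linear_fst])
    then show ?thesis by (simp add: h_def profile_def)
  qed
  then have "smooth_map UNIV (\<bullet>) F"
    unfolding F_def by (rule smooth_swirl)
  moreover have "p \<bullet> F p \<le> 0" for p
    by (simp add: F_def swirl_orthogonal)
  moreover have "norm (F x - F y) \<le> L * norm (x - y)" for x y
  proof -
    have "norm (F x - F y) = c * norm (swirl \<kappa> h x - swirl \<kappa> h y)"
      using \<open>c > 0\<close> by (simp add: F_def flip: scaleR_diff_right)
    also have "\<dots> \<le> c * (\<Lambda> * norm (x - y))"
      using lip \<open>c > 0\<close> by (intro mult_left_mono) auto
    also have "\<dots> = L * norm (x - y)" using \<open>\<Lambda> > 0\<close> by (simp add: c_def)
    finally show ?thesis .
  qed
  moreover have "transported_map \<phi> F \<in> range \<phi> \<rightarrow> range \<phi>"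
    by (auto simp: transported_map_def)
  ultimately have "strongly_stable s a b (range \<phi>) (transported_inner \<phi>) (transported_map \<phi> F)"
    using stable \<phi> \<open>L > 0\<close>
    by (simp add: semi_inner_space_transported smooth_map_transported semibounded_transported
        lip_seminorm_transported_le)
  then obtain dtmax where "dtmax > 0" and decay: "\<And>p dt. dt \<in> {0<..dtmax} \<Longrightarrow>
      (seminorm (transported_inner \<phi>) (rk_step s a b (transported_map \<phi> F) dt (\<phi> p)))\<^sup>2
        \<le> (seminorm (transported_inner \<phi>) (\<phi> p))\<^sup>2"
    unfolding strongly_stable_def by blast
  have contraction: "norm (rk_step s a b (swirl \<kappa> h) (c * dt) p) \<le> norm p"
    if "dt \<in> {0<..dtmax}" for p dt
  proof -
    have "rk_step s a b (transported_map \<phi> F) dt (\<phi> p) = \<phi> (rk_step s a b F dt p)"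
      by (intro rk_step_commutes \<phi> transported_map_apply)
    moreover have "rk_step s a b F dt p = rk_step s a b (swirl \<kappa> h) (c * dt) p"
      using rk_step_rescale_time[of s a b c "swirl \<kappa> h"] by (simp add: F_def[abs_def])
    ultimately show ?thesis
      using decay[OF that, of p] by (simp add: seminorm_transported[OF \<phi>(2)])
  qed
  define dt where "dt = min dtmax (d / (2 * c))"
  have "dt \<in> {0<..dtmax}" "c * dt \<in> {0<..<d}"
    using \<open>dtmax > 0\<close> \<open>d > 0\<close> \<open>c > 0\<close> by (auto simp: dt_def min_def field_simps)
  with contraction growth show False unfolding step by (meson not_le)
qed

end
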